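(* Let $X$ be a compact $0$-dimensional Hausdorff space. If $C(X)$ is countably saturated, then the Boolean algebra $CL(X)$ is countably saturated; and if $CL(X)$ is countably saturated, then $C(X)$ is countably quantifier-free saturated.
   Context: $CL(X)$ is the Boolean algebra of clopen subsets of $X$. A Boolean algebra is countably saturated ($\aleph_1$-saturated) if every type of cardinality $<\aleph_1$ in the first-order language of Boolean algebras (with parameters) which is finitely satisfiable is realized. Formulas of continuous logic for $\mathrm{C}^*$-algebras: $\|P(\bar x)\|$ for a $^*$-polynomial $P$ with complex coefficients (possibly with parameters from the algebra) is a formula; if $\phi_1,\dots,\phi_n$ are formulas and $f\colon\mathbb R^n\to\mathbb R$ continuous then $f(\phi_1,\dots,\phi_n)$ is a formula; if $\phi(\bar x,y)$ is a formula and $n\in\mathbb N$ then $\sup_{\|y\|\le n}\phi$ and $\inf_{\|y\|\le n}\phi$ are formulas. Quantifier-free formulas are those built without $\sup$/$\inf$. For a class $\Phi$ of formulas, a $\mathrm{C}^*$-algebra $C$ is countably $\Phi$-saturated if for every sequence $(\phi_n)$ of formulas from $\Phi$ with parameters from the unit ball $C_{\le1}$ and every sequence $(K_n)$ of compact subsets of $\mathbb R$: if for every $\epsilon>0$ and finite $F\subseteq\mathbb N$ there is $(b_k)\subseteq C_{\le1}$ with $\phi_n^C(\bar b)\in (K_n)_\epsilon=\{t:d(t,K_n)<\epsilon\}$ for $n\in F$, then there is $(b_k)\subseteq C_{\le1}$ with $\phi_n^C(\bar b)\in K_n$ for all $n$. Countably saturated means $\Phi$ = all formulas; countably quantifier-free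 saturated means $\Phi$ = quantifier-free formulas. *)

theory Defs
  imports "HOL-Analysis.Analysis"
begin

section \<open>First-order logic of Boolean algebras\<close>

text \<open>Structures have an explicit carrier, since the operations of \<open>CL(X)\<close> depend on the space \<open>X\<close>,
  which is a value rather than a type.\<close>

record 'b bool_alg =
  ba_carrier :: "'b set"
  ba_meet :: "'b \<Rightarrow> 'b \<Rightarrow> 'b"
  ba_join :: "'b \<Rightarrow> 'b \<Rightarrow> 'b"
  ba_compl :: "'b \<Rightarrow> 'b"
  ba_zero :: "'b"
  ba_one :: "'b"

datatype 'b ba_term =
    BVar nat
  | BParam 'b
  | BZero
  | BOne
  | BMeet "'b ba_term" "'b ba_term"
  | BJoin "'b ba_term" "'b ba_term"
  | BCompl "'b ba_term"

text \<open>Variables are named; \<open>BEx k\<close> binds the variable with index \<open>k\<close>.\<close>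

datatype 'b ba_formula =
    BEq "'b ba_term" "'b ba_term"
  | BNot "'b ba_formula"
  | BAnd "'b ba_formula" "'b ba_formula"
  | BOr "'b ba_formula" "'b ba_formula"
  | BEx nat "'b ba_formula"
  | BAll nat "'b ba_formula"

primrec ba_eval :: "'b bool_alg \<Rightarrow> (nat \<Rightarrow> 'b) \<Rightarrow> 'b ba_term \<Rightarrow> 'b" where
  "ba_eval B v (BVar k) = v k"
| "ba_eval B v (BParam a) = a"
| "ba_eval B v BZero = ba_zero B"
| "ba_eval B v BOne = ba_one B"
| "ba_eval B v (BMeet s t) = ba_meet B (ba_eval B v s) (ba_eval B v t)"
| "ba_eval B v (BJoin s t) = ba_join B (ba_eval B v s) (ba_eval B v t)"
| "ba_eval B v (BCompl t) = ba_compl B (ba_eval B v t)"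

primrec ba_sat :: "'b bool_alg \<Rightarrow> (nat \<Rightarrow> 'b) \<Rightarrow> 'b ba_formula \<Rightarrow> bool" where
  "ba_sat B v (BEq s t) \<longleftrightarrow> ba_eval B v s = ba_eval B v t"
| "ba_sat B v (BNot p) \<longleftrightarrow> \<not> ba_sat B v p"
| "ba_sat B v (BAnd p q) \<longleftrightarrow> ba_sat B v p \<and> ba_sat B v q"
| "ba_sat B v (BOr p q) \<longleftrightarrow> ba_sat B v p \<or> ba_sat B v q"
| "ba_sat B v (BEx k p) \<longleftrightarrow> (\<exists>a\<in>ba_carrier B. ba_sat B (v(k := a)) p)"
| "ba_sat B v (BAll k p) \<longleftrightarrow> (\<forall>a\<in>ba_carrier B. ba_sat B (v(k := a)) p)"

text \<open>The generated function \<open>set_ba_formula\<close> collects the parameters of a formula.  Since a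
  countable set of formulas has at most countably many free variables, types in the variables
  indexed by \<open>nat\<close> cover all countable types.\<close>

definition ba_countably_saturated :: "'b bool_alg \<Rightarrow> bool" where
  "ba_countably_saturated B \<longleftrightarrow>
     (\<forall>T. countable T \<and> (\<forall>p\<in>T. set_ba_formula p \<subseteq> ba_carrier B) \<and>
        (\<forall>S\<subseteq>T. finite S \<longrightarrow> (\<exists>v. (\<forall>k. v k \<in> ba_carrier B) \<and> (\<forall>p\<in>S. ba_sat B v p)))
      \<longrightarrow> (\<exists>v. (\<forall>k. v k \<in> ba_carrier B) \<and> (\<forall>p\<in>T. ba_sat B v p)))"


section \<open>Continuous logic of C*-algebras\<close>

record 'c cstar =
  cs_carrier :: "'c set"
  cs_add :: "'c \<Rightarrow> 'c \<Rightarrow> 'c"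
  cs_scale :: "complex \<Rightarrow> 'c \<Rightarrow> 'c"
  cs_mult :: "'c \<Rightarrow> 'c \<Rightarrow> 'c"
  cs_star :: "'c \<Rightarrow> 'c"
  cs_norm :: "'c \<Rightarrow> real"

definition cs_ball :: "'c cstar \<Rightarrow> nat \<Rightarrow> 'c set" where
  "cs_ball C n = {a \<in> cs_carrier C. cs_norm C a \<le> real n}"

text \<open>Terms for *-polynomials.  A constant term \<open>c\<close> over a unital algebra is
  \<open>PScale c (PParam 1)\<close>.\<close>

datatype 'c star_poly =
    PVar nat
  | PParam 'c
  | PAdd "'c star_poly" "'c star_poly"
  | PScale complex "'c star_poly"
  | PMult "'c star_poly" "'c star_poly"
  | PStar "'c star_poly"

text \<open>\<open>CSup n k \<phi>\<close> and \<open>CInf n k \<phi>\<close> bind the variable with index \<open>k\<close>, which ranges over the ball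
  of radius \<open>n\<close>.\<close>

datatype 'c cformula =
    CNorm "'c star_poly"
  | CComb "(nat \<Rightarrow> real) \<Rightarrow> real" "'c cformula list"
  | CSup nat nat "'c cformula"
  | CInf nat nat "'c cformula"

primrec poly_eval :: "'c cstar \<Rightarrow> (nat \<Rightarrow> 'c) \<Rightarrow> 'c star_poly \<Rightarrow> 'c" where
  "poly_eval C v (PVar k) = v k"
| "poly_eval C v (PParam a) = a"
| "poly_eval C v (PAdd p q) = cs_add C (poly_eval C v p) (poly_eval C v q)"
| "poly_eval C v (PScale c p) = cs_scale C c (poly_eval C v p)"
| "poly_eval C v (PMult p q) = cs_mult C (poly_eval C v p) (poly_eval C v q)"
| "poly_eval C v (PStar p) = cs_star C (poly_eval C v p)"

text \<open>As in the library's \<open>Euclidean_space n\<close>, a point of \<open>\<real>\<^sup>n\<close> is a sequence that vanishes from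
  index \<open>n\<close> on.\<close>

fun cf_eval :: "'c cstar \<Rightarrow> (nat \<Rightarrow> 'c) \<Rightarrow> 'c cformula \<Rightarrow> real" where
  "cf_eval C v (CNorm p) = cs_norm C (poly_eval C v p)"
| "cf_eval C v (CComb f ps) =
     f (\<lambda>i. if i < length ps then map (cf_eval C v) ps ! i else 0)"
| "cf_eval C v (CSup n k p) = (SUP a\<in>cs_ball C n. cf_eval C (v(k := a)) p)"
| "cf_eval C v (CInf n k p) = (INF a\<in>cs_ball C n. cf_eval C (v(k := a)) p)"

fun cf_wf :: "'c cformula \<Rightarrow> bool" where
  "cf_wf (CNorm p) \<longleftrightarrow> True"
| "cf_wf (CComb f ps) \<longleftrightarrow>
     continuous_map (Euclidean_space (length ps)) euclideanreal f \<and> (\<forall>p\<in>set ps. cf_wf p)"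
| "cf_wf (CSup n k p) \<longleftrightarrow> cf_wf p"
| "cf_wf (CInf n k p) \<longleftrightarrow> cf_wf p"

fun cf_quantifier_free :: "'c cformula \<Rightarrow> bool" where
  "cf_quantifier_free (CNorm p) \<longleftrightarrow> True"
| "cf_quantifier_free (CComb f ps) \<longleftrightarrow> (\<forall>p\<in>set ps. cf_quantifier_free p)"
| "cf_quantifier_free (CSup n k p) \<longleftrightarrow> False"
| "cf_quantifier_free (CInf n k p) \<longleftrightarrow> False"

text \<open>The library sets \<open>infdist t {} = 0\<close>, whereas the distance to the empty set is infinite here.\<close>

definition thicken :: "real set \<Rightarrow> real \<Rightarrow> real set" where
  "thicken K e = {t. K \<noteq> {} \<and> infdist t K < e}"

definition cs_countably_saturated_for :: "'c cformula set \<Rightarrow> 'c cstar \<Rightarrow> bool" where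
  "cs_countably_saturated_for \<Phi> C \<longleftrightarrow>
     (\<forall>(\<phi> :: nat \<Rightarrow> 'c cformula) (K :: nat \<Rightarrow> real set).
        (\<forall>n. \<phi> n \<in> \<Phi> \<and> set_cformula (\<phi> n) \<subseteq> cs_ball C 1) \<and> (\<forall>n. compact (K n)) \<and>
        (\<forall>e>0. \<forall>F. finite F \<longrightarrow>
           (\<exists>b. (\<forall>k. b k \<in> cs_ball C 1) \<and> (\<forall>n\<in>F. cf_eval C b (\<phi> n) \<in> thicken (K n) e)))
      \<longrightarrow> (\<exists>b. (\<forall>k. b k \<in> cs_ball C 1) \<and> (\<forall>n. cf_eval C b (\<phi> n) \<in> K n)))"

definition cs_countably_saturated :: "'c cstar \<Rightarrow> bool" where
  "cs_countably_saturated = cs_countably_saturated_for {\<phi>. cf_wf \<phi>}"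

definition cs_countably_qf_saturated :: "'c cstar \<Rightarrow> bool" where
  "cs_countably_qf_saturated = cs_countably_saturated_for {\<phi>. cf_wf \<phi> \<and> cf_quantifier_free \<phi>}"


section \<open>The structures attached to a compact space\<close>

definition zero_dimensional_space :: "'a topology \<Rightarrow> bool" where
  "zero_dimensional_space X \<longleftrightarrow>
     (\<forall>U x. openin X U \<and> x \<in> U \<longrightarrow> (\<exists>V. openin X V \<and> closedin X V \<and> x \<in> V \<and> V \<subseteq> U))"

definition clopen_algebra :: "'a topology \<Rightarrow> 'a set bool_alg" where
  "clopen_algebra X =
     \<lparr>ba_carrier = {U. openin X U \<and> closedin X U},
      ba_meet = (\<inter>),
      ba_join = (\<union>),
      ba_compl = (\<lambda>U. topspace X - U),
      ba_zero = {},
      ba_one = topspace X\<rparr>"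

text \<open>Continuous functions are taken extensional so that equality in the carrier is equality on
  \<open>topspace X\<close>.  The case distinction in the norm covers the empty space, as \<open>Sup {}\<close> is
  unspecified on the reals.\<close>

definition cont_algebra :: "'a topology \<Rightarrow> ('a \<Rightarrow> complex) cstar" where
  "cont_algebra X =
     \<lparr>cs_carrier = {f \<in> extensional (topspace X). continuous_map X euclidean f},
      cs_add = (\<lambda>f g. \<lambda>x\<in>topspace X. f x + g x),
      cs_scale = (\<lambda>c f. \<lambda>x\<in>topspace X. c * f x),
      cs_mult = (\<lambda>f g. \<lambda>x\<in>topspace X. f x * g x),
      cs_star = (\<lambda>f. \<lambda>x\<in>topspace X. cnj (f x)),
      cs_norm = (\<lambda>f. if topspace X = {} then 0 else SUP x\<in>topspace X. cmod (f x))\<rparr>"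

end

theory Submission
  imports Defs "HOL-Library.Diagonal_Subsequence"
begin

text \<open>A clopen set is a projection of \<open>C(X)\<close>, and projections are the zeros of \<open>\<parallel>y\<^sup>* y - y\<parallel>\<close>; an
  approximate zero is close to a projection.  Hence every first-order formula \<open>p\<close> over \<open>CL(X)\<close> has a
  continuous formula that takes the value \<open>0\<close> or \<open>1\<close> near tuples of projections, according to whether
  \<open>p\<close> holds, and countable types transfer from \<open>CL(X)\<close> to \<open>C(X)\<close>.

  Conversely, every element of the unit ball is \<open>f = \<Sum>j. c j * 1\<^bsub>V j\<^esub> - const\<close> for a fixed summable
  sequence \<open>c\<close> and clopen \<open>V j\<close>, the digits of \<open>f\<close>.  The norm of a *-polynomial is determined up to a
  small error by which finite digit patterns occur at some point of \<open>X\<close>.  Given tuples that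
  satisfy more and more conditions ever better, pass to a subsequence along which every finite
  pattern either eventually occurs or eventually does not; by saturation of \<open>CL(X)\<close> some tuple
  realizes exactly the limit patterns, and all quantifier-free formulas take their limit values there.\<close>

section \<open>The algebras of a compact space\<close>

lemma cont_algebra_sel [simp]:
  "cs_carrier (cont_algebra X) = {f \<in> extensional (topspace X). continuous_map X euclidean f}"
  "cs_add (cont_algebra X) f g = (\<lambda>x\<in>topspace X. f x + g x)"
  "cs_scale (cont_algebra X) c f = (\<lambda>x\<in>topspace X. c * f x)"
  "cs_mult (cont_algebra X) f g = (\<lambda>x\<in>topspace X. f x * g x)"
  "cs_star (cont_algebra X) f = (\<lambda>x\<in>topspace X. cnj (f x))"
  by (simp_all add: cont_algebra_def)

lemma cs_norm_cont_algebra: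
  "cs_norm (cont_algebra X) f = (if topspace X = {} then 0 else SUP x\<in>topspace X. cmod (f x))"
  by (simp add: cont_algebra_def)

lemma clopen_algebra_sel [simp]:
  "ba_carrier (clopen_algebra X) = {U. openin X U \<and> closedin X U}"
  "ba_meet (clopen_algebra X) = (\<inter>)"
  "ba_join (clopen_algebra X) = (\<union>)"
  "ba_compl (clopen_algebra X) U = topspace X - U"
  "ba_zero (clopen_algebra X) = {}"
  "ba_one (clopen_algebra X) = topspace X"
  by (simp_all add: clopen_algebra_def)

lemma bdd_above_cmod_image:
  assumes "compact_space X" "continuous_map X euclidean f"
  shows "bdd_above ((\<lambda>x. cmod (f x)) ` topspace X)"
proof -
  have "compactin euclidean (f ` topspace X)"
    using assms by (metis compact_space_def image_compactin)
  then have "bounded (f ` topspace X)"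
    by (simp add: compact_imp_bounded)
  then show ?thesis
    by (auto simp: bounded_iff bdd_above_def)
qed

lemma cmod_le_cs_norm:
  assumes "compact_space X" "continuous_map X euclidean f" "x \<in> topspace X"
  shows "cmod (f x) \<le> cs_norm (cont_algebra X) f"
  using cSUP_upper[OF assms(3) bdd_above_cmod_image[OF assms(1,2)]] assms(3)
  by (auto simp: cont_algebra_def)

lemma cs_norm_cont_algebra_le_iff:
  assumes "compact_space X" "continuous_map X euclidean f" "0 \<le> r"
  shows "cs_norm (cont_algebra X) f \<le> r \<longleftrightarrow> (\<forall>x\<in>topspace X. cmod (f x) \<le> r)"
  using bdd_above_cmod_image[OF assms(1,2)] assms(3) by (simp add: cont_algebra_def cSUP_le_iff)

lemma cs_ball_cont_algebra:
  assumes "compact_space X"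
  shows "cs_ball (cont_algebra X) n = {f \<in> extensional (topspace X). continuous_map X euclidean f \<and>
     (\<forall>x\<in>topspace X. cmod (f x) \<le> real n)}"
  using cs_norm_cont_algebra_le_iff[OF assms] by (auto simp: cs_ball_def)

lemma continuous_map_restrict_topspace:
  "continuous_map X Y (\<lambda>x\<in>topspace X. f x) \<longleftrightarrow> continuous_map X Y f"
  by (auto intro: continuous_map_eq)

lemma poly_eval_in_carrier:
  assumes "\<forall>k. b k \<in> cs_carrier (cont_algebra X)"
    and "set_star_poly P \<subseteq> cs_carrier (cont_algebra X)"
  shows "poly_eval (cont_algebra X) b P \<in> cs_carrier (cont_algebra X)"
proof -
  \<comment> \<open>Over an abstract topology, continuity is read as convergence at every point,
    where the limit rules for complex numbers apply.\<close>
  have "continuous_map X euclidean (\<lambda>x. f x + g x)" "continuous_map X euclidean (\<lambda>x. c * f x)"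
    "continuous_map X euclidean (\<lambda>x. f x * g x)" "continuous_map X euclidean (\<lambda>x. cnj (f x))"
    if "continuous_map X euclidean f" "continuous_map X euclidean g" for f g :: "'a \<Rightarrow> complex" and c
    using that unfolding continuous_map_atin limitin_canonical_iff by (auto intro!: tendsto_intros)
  then show ?thesis
    using assms by (induction P) (auto simp: continuous_map_restrict_topspace)
qed

section \<open>From continuous to classical saturation\<close>

definition clopen_char :: "'a topology \<Rightarrow> 'a set \<Rightarrow> 'a \<Rightarrow> complex" where
  "clopen_char X U = (\<lambda>x\<in>topspace X. of_bool (x \<in> U))"

lemma continuous_map_of_bool_clopen:
  assumes "openin X U" "closedin X U"
  shows "continuous_map X euclidean (\<lambda>x. of_bool (x \<in> U) :: 'b :: {topological_space, zero_neq_one})"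
proof (subst continuous_map_def, intro conjI allI impI)
  fix W :: "'b set"
  have "openin X (topspace X - U)" using assms by blast
  moreover have "{x \<in> topspace X. of_bool (x \<in> U) \<in> W} =
      (if 1 \<in> W then U else {}) \<union> (if 0 \<in> W then topspace X - U else {})"
    using openin_subset[OF assms(1)] by (auto split: if_splits)
  ultimately show "openin X {x \<in> topspace X. of_bool (x \<in> U) \<in> W}"
    using assms by auto
qed auto

lemma clopen_char_in_ball:
  assumes "compact_space X" "openin X U" "closedin X U"
  shows "clopen_char X U \<in> cs_ball (cont_algebra X) 1"
proof -
  have "continuous_map X euclidean (clopen_char X U)"
    using continuous_map_of_bool_clopen[OF assms(2,3)]
    by (simp add: clopen_char_def continuous_map_restrict_topspace)
  then show ?thesis
    using assms(1) by (auto simp: cs_ball_cont_algebra clopen_char_def)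
qed

text \<open>These are the algebraic identities for characteristic functions, join being
  inclusion-exclusion. \<open>BZero\<close> and \<open>BOne\<close> become parameters because
  *-polynomials have no constant terms.\<close>

primrec term_poly :: "'a topology \<Rightarrow> 'a set ba_term \<Rightarrow> ('a \<Rightarrow> complex) star_poly" where
  "term_poly X (BVar k) = PVar k"
| "term_poly X (BParam U) = PParam (clopen_char X U)"
| "term_poly X BZero = PParam (clopen_char X {})"
| "term_poly X BOne = PParam (clopen_char X (topspace X))"
| "term_poly X (BMeet s t) = PMult (term_poly X s) (term_poly X t)"
| "term_poly X (BJoin s t) = PAdd (PAdd (term_poly X s) (term_poly X t))
     (PScale (-1) (PMult (term_poly X s) (term_poly X t)))"
| "term_poly X (BCompl t) = PAdd (PParam (clopen_char X (topspace X))) (PScale (-1) (term_poly X t))"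

lemma set_term_poly:
  assumes "compact_space X" "set_ba_term t \<subseteq> ba_carrier (clopen_algebra X)"
  shows "set_star_poly (term_poly X t) \<subseteq> cs_ball (cont_algebra X) 1"
  using assms(2) by (induction t) (auto intro: clopen_char_in_ball[OF assms(1)] simp del: One_nat_def)

lemma ba_eval_clopen:
  assumes "\<forall>k. v k \<in> ba_carrier (clopen_algebra X)"
    and "set_ba_term t \<subseteq> ba_carrier (clopen_algebra X)"
  shows "ba_eval (clopen_algebra X) v t \<in> ba_carrier (clopen_algebra X)"
  using assms by (induction t) auto

text \<open>All variables are constrained at once, with the same bound at all points, so free
  variables of formulas need no bookkeeping.\<close>

definition near_char :: "'a topology \<Rightarrow> real \<Rightarrow> (nat \<Rightarrow> 'a \<Rightarrow> complex) \<Rightarrow> (nat \<Rightarrow> 'a set) \<Rightarrow> bool" where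
  "near_char X d b v \<longleftrightarrow> (\<forall>k. \<forall>x\<in>topspace X. cmod (b k x - of_bool (x \<in> v k)) < d)"

lemma near_char_mono: "near_char X d b v \<Longrightarrow> d \<le> e \<Longrightarrow> near_char X e b v"
  unfolding near_char_def by (meson less_le_trans)

text \<open>Replace one factor at a time: the first error is multiplied by \<open>b\<close>, whose
  modulus is at most 2 because \<open>d \<le> 1\<close>, the second by 0 or 1.\<close>

lemma norm_mult_diff_of_bool_less:
  fixes a b :: complex
  assumes "cmod (a - of_bool p) < d" "cmod (b - of_bool q) < d" "d \<le> 1"
  shows "cmod (a * b - of_bool (p \<and> q)) < 3 * d"
proof -
  have "a * b - of_bool (p \<and> q) = (a - of_bool p) * b + of_bool p * (b - of_bool q)"
    by (simp add: algebra_simps)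
  also have "cmod \<dots> \<le> cmod (a - of_bool p) * cmod b + cmod (b - of_bool q)"
    by (rule norm_triangle_le) (auto simp: norm_mult)
  also have "cmod b \<le> 2"
    using norm_triangle_sub[of b "of_bool q"] assms by (cases q) auto
  then have "cmod (a - of_bool p) * cmod b \<le> cmod (a - of_bool p) * 2"
    by (intro mult_left_mono) auto
  finally show ?thesis using assms by simp
qed

text \<open>The polynomials depend continuously on the values of the variables, and at values 0 and
  1 they compute the Boolean operations. The radius \<open>d\<close> depends only on
  \<open>t\<close>, \<open>e\<close> and \<open>X\<close>, not on \<open>b\<close>, \<open>v\<close>
  or the point.\<close>

lemma term_poly_near:
  assumes "e > 0"
  shows "\<exists>d>0. \<forall>b v. near_char X d b v \<longrightarrow> (\<forall>x\<in>topspace X.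
     cmod (poly_eval (cont_algebra X) b (term_poly X t) x
       - of_bool (x \<in> ba_eval (clopen_algebra X) v t)) < e)"
  using assms
proof (induction t arbitrary: e)
  case (BMeet s t)
  \<comment> \<open>A product triples the error, and the product estimate needs errors of at most
    1.\<close>
  define e' where "e' = min 1 (e/3)"
  have e': "e' > 0" "e' \<le> 1" "3 * e' \<le> e" using BMeet.prems by (auto simp: e'_def)
  from BMeet.IH(1)[OF e'(1)] BMeet.IH(2)[OF e'(1)] obtain d1 d2 where
    d: "d1 > 0" "d2 > 0"
    "\<And>b v x. near_char X d1 b v \<Longrightarrow> x\<in>topspace X \<Longrightarrow>
     cmod (poly_eval (cont_algebra X) b (term_poly X s) x
       - of_bool (x \<in> ba_eval (clopen_algebra X) v s)) < e'"
    "\<And>b v x. near_char X d2 b v \<Longrightarrow> x\<in>topspace X \<Longrightarrow>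
     cmod (poly_eval (cont_algebra X) b (term_poly X t) x
       - of_bool (x \<in> ba_eval (clopen_algebra X) v t)) < e'" by metis
  show ?case
  proof (intro exI[of _ "min d1 d2"] conjI allI impI ballI)
    fix b v x assume nr: "near_char X (min d1 d2) b v" and x: "x \<in> topspace X"
    have "near_char X d1 b v" "near_char X d2 b v" using near_char_mono[OF nr] by auto
    from norm_mult_diff_of_bool_less[OF d(3)[OF this(1) x] d(4)[OF this(2) x] e'(2)]
    show "cmod (poly_eval (cont_algebra X) b (term_poly X (BMeet s t)) x
       - of_bool (x \<in> ba_eval (clopen_algebra X) v (BMeet s t))) < e"
      using x e'(3) by (simp add: of_bool_def)
  qed (use d in auto)
next
  case (BJoin s t)
  \<comment> \<open>One error from each summand and three from the product add up to five.\<close>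
  define e' where "e' = min 1 (e/5)"
  have e': "e' > 0" "e' \<le> 1" "5 * e' \<le> e" using BJoin.prems by (auto simp: e'_def)
  from BJoin.IH(1)[OF e'(1)] BJoin.IH(2)[OF e'(1)] obtain d1 d2 where
    d: "d1 > 0" "d2 > 0"
    "\<And>b v x. near_char X d1 b v \<Longrightarrow> x\<in>topspace X \<Longrightarrow>
     cmod (poly_eval (cont_algebra X) b (term_poly X s) x
       - of_bool (x \<in> ba_eval (clopen_algebra X) v s)) < e'"
    "\<And>b v x. near_char X d2 b v \<Longrightarrow> x\<in>topspace X \<Longrightarrow>
     cmod (poly_eval (cont_algebra X) b (term_poly X t) x
       - of_bool (x \<in> ba_eval (clopen_algebra X) v t)) < e'" by metis
  show ?case
  proof (intro exI[of _ "min d1 d2"] conjI allI impI ballI)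
    fix b v x assume nr: "near_char X (min d1 d2) b v" and x: "x \<in> topspace X"
    define p where "p = poly_eval (cont_algebra X) b (term_poly X s) x"
    define q where "q = poly_eval (cont_algebra X) b (term_poly X t) x"
    define P where "P \<longleftrightarrow> x \<in> ba_eval (clopen_algebra X) v s"
    define Q where "Q \<longleftrightarrow> x \<in> ba_eval (clopen_algebra X) v t"
    have "near_char X d1 b v" "near_char X d2 b v" using near_char_mono[OF nr] by auto
    then have pq: "cmod (p - of_bool P) < e'" "cmod (q - of_bool Q) < e'"
      using d x by (auto simp: p_def q_def P_def Q_def)
    note m = norm_mult_diff_of_bool_less[OF pq e'(2)]
    have "p + q - p * q - of_bool (P \<or> Q) =
        (p - of_bool P) + (q - of_bool Q) - (p * q - of_bool (P \<and> Q))"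
      by auto
    also have "cmod \<dots> < e' + e' + 3 * e'"
      using norm_triangle_ineq4[of "(p - of_bool P) + (q - of_bool Q)" "p * q - of_bool (P \<and> Q)"]
        norm_triangle_ineq[of "p - of_bool P" "q - of_bool Q"] pq m by linarith
    finally show "cmod (poly_eval (cont_algebra X) b (term_poly X (BJoin s t)) x
       - of_bool (x \<in> ba_eval (clopen_algebra X) v (BJoin s t))) < e"
      using x e'(3) by (simp add: p_def q_def P_def Q_def of_bool_def)
  qed (use d in auto)
next
  case (BCompl t)
  from BCompl.IH[OF BCompl.prems] obtain d where "d > 0" and
    d: "\<And>b v x. near_char X d b v \<Longrightarrow> x\<in>topspace X \<Longrightarrow>
     cmod (poly_eval (cont_algebra X) b (term_poly X t) x
       - of_bool (x \<in> ba_eval (clopen_algebra X) v t)) < e" by metis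
  show ?case
  proof (intro exI[of _ d] conjI allI impI ballI)
    fix b v x assume "near_char X d b v" "x \<in> topspace X"
    with d[OF this] show "cmod (poly_eval (cont_algebra X) b (term_poly X (BCompl t)) x
       - of_bool (x \<in> ba_eval (clopen_algebra X) v (BCompl t))) < e"
      by (simp add: clopen_char_def norm_minus_commute of_bool_def split: if_splits)
  qed fact
next
  case (BVar k)
  then show ?case by (intro exI[of _ e]) (auto simp: near_char_def)
qed (auto simp: clopen_char_def intro!: exI[of _ 1])

section \<open>Translation of first-order formulas into continuous formulas\<close>

lemma continuous_map_Euclidean_space_coord: "continuous_map (Euclidean_space n) euclideanreal (\<lambda>x. x i)"
  unfolding Euclidean_space_def by (intro continuous_map_from_subtopology continuous_map_product_projection) auto

text \<open>Truth corresponds to the value \<open>0\<close>.  The value is prescribed near tuples of projections, not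
  only at them, because quantifiers of continuous formulas range over the whole ball.\<close>

definition translates :: "'a topology \<Rightarrow> ('a \<Rightarrow> complex) cformula \<Rightarrow> 'a set ba_formula \<Rightarrow> bool" where
  "translates X \<phi> p \<longleftrightarrow>
     cf_wf \<phi> \<and> set_cformula \<phi> \<subseteq> cs_ball (cont_algebra X) 1 \<and>
     (\<forall>b. (\<forall>k. b k \<in> cs_ball (cont_algebra X) 1) \<longrightarrow> cf_eval (cont_algebra X) b \<phi> \<in> {0..1}) \<and>
     (\<exists>d>0. \<forall>b v. (\<forall>k. b k \<in> cs_ball (cont_algebra X) 1) \<and> (\<forall>k. v k \<in> ba_carrier (clopen_algebra X)) \<and>
        near_char X d b v \<longrightarrow>
        cf_eval (cont_algebra X) b \<phi> = of_bool (\<not> ba_sat (clopen_algebra X) v p))"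

text \<open>Lets disjunction and universal quantification be obtained by duality from negation,
  conjunction and existential quantification.\<close>

lemma translates_cong:
  assumes "translates X \<phi> p"
    and "\<And>v. \<forall>k. v k \<in> ba_carrier (clopen_algebra X) \<Longrightarrow>
          ba_sat (clopen_algebra X) v p \<longleftrightarrow> ba_sat (clopen_algebra X) v q"
  shows "translates X \<phi> q"
proof -
  obtain d where "d > 0" "\<And>b v. (\<forall>k. b k \<in> cs_ball (cont_algebra X) 1) \<Longrightarrow>
     (\<forall>k. v k \<in> ba_carrier (clopen_algebra X)) \<Longrightarrow> near_char X d b v \<Longrightarrow>
     cf_eval (cont_algebra X) b \<phi> = of_bool (\<not> ba_sat (clopen_algebra X) v p)"
    using assms(1) unfolding translates_def by blast
  then have "\<exists>d>0. \<forall>b v. (\<forall>k. b k \<in> cs_ball (cont_algebra X) 1) \<and> (\<forall>k. v k \<in> ba_carrier (clopen_algebra X)) \<and>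
        near_char X d b v \<longrightarrow>
        cf_eval (cont_algebra X) b \<phi> = of_bool (\<not> ba_sat (clopen_algebra X) v q)"
    using assms(2) by (intro exI[of _ d]) auto
  then show ?thesis using assms(1) unfolding translates_def by blast
qed

text \<open>Characteristic functions of distinct clopen sets differ by 1 at some point. Near
  projections the norm of the difference is therefore at most 1/4 or at least 3/4, and a truncated
  affine function turns this gap into the exact values 0 and 1.\<close>

lemma translates_BEq:
  assumes X: "compact_space X"
    and par: "set_ba_term s \<subseteq> ba_carrier (clopen_algebra X)" "set_ba_term t \<subseteq> ba_carrier (clopen_algebra X)"
  shows "\<exists>\<phi>. translates X \<phi> (BEq s t)"
proof -
  define P where "P = PAdd (term_poly X s) (PScale (-1) (term_poly X t))"
  define \<phi> where "\<phi> = CComb (\<lambda>x. max 0 (min 1 (2 * x 0 - 1/2))) [CNorm P]"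
  have eval: "cf_eval (cont_algebra X) b \<phi> = max 0 (min 1 (2 * cs_norm (cont_algebra X) (poly_eval (cont_algebra X) b P) - 1/2))" for b
    by (simp add: \<phi>_def)
  have Pset: "set_star_poly P \<subseteq> cs_ball (cont_algebra X) 1"
    using set_term_poly[OF X] par by (auto simp: P_def)
  \<comment> \<open>The two errors of 1/8 add up to the 1/4 of the gap.\<close>
  obtain d1 d2 where d: "d1 > 0" "d2 > 0"
    "\<And>b v x. near_char X d1 b v \<Longrightarrow> x\<in>topspace X \<Longrightarrow>
     cmod (poly_eval (cont_algebra X) b (term_poly X s) x
       - of_bool (x \<in> ba_eval (clopen_algebra X) v s)) < 1/8"
    "\<And>b v x. near_char X d2 b v \<Longrightarrow> x\<in>topspace X \<Longrightarrow>
     cmod (poly_eval (cont_algebra X) b (term_poly X t) x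
       - of_bool (x \<in> ba_eval (clopen_algebra X) v t)) < 1/8"
    using term_poly_near[of "1/8" X s] term_poly_near[of "1/8" X t] by force
  have "translates X \<phi> (BEq s t)"
    unfolding translates_def
  proof (intro conjI allI impI exI[of _ "min d1 d2"])
    show "cf_wf \<phi>" unfolding \<phi>_def cf_wf.simps
      by (intro conjI continuous_intros continuous_map_Euclidean_space_coord) auto
    show "set_cformula \<phi> \<subseteq> cs_ball (cont_algebra X) 1" using Pset by (auto simp: \<phi>_def)
    fix b :: "nat \<Rightarrow> 'a \<Rightarrow> complex" assume "\<forall>k. b k \<in> cs_ball (cont_algebra X) 1"
    then show "cf_eval (cont_algebra X) b \<phi> \<in> {0..1}" by (auto simp: eval)
  next
    fix b v assume *: "(\<forall>k. b k \<in> cs_ball (cont_algebra X) 1) \<and> (\<forall>k. v k \<in> ba_carrier (clopen_algebra X)) \<and>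
        near_char X (min d1 d2) b v"
    then have bc: "\<forall>k. b k \<in> cs_carrier (cont_algebra X)" unfolding cs_ball_def by blast
    let ?f = "poly_eval (cont_algebra X) b P"
    have "?f \<in> cs_carrier (cont_algebra X)" using Pset bc
      by (intro poly_eval_in_carrier) (auto simp: cs_ball_def)
    then have fc: "continuous_map X euclidean ?f" by simp
    define S where "S = ba_eval (clopen_algebra X) v s"
    define T where "T = ba_eval (clopen_algebra X) v t"
    have sub: "S \<subseteq> topspace X" "T \<subseteq> topspace X"
      using ba_eval_clopen[OF _ par(1), of v] ba_eval_clopen[OF _ par(2), of v] *
      by (auto simp: S_def T_def dest: openin_subset)
    have close: "cmod (?f x - (of_bool (x \<in> S) - of_bool (x \<in> T))) < 1/4" if x: "x \<in> topspace X" for x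
    proof -
      define p where "p = poly_eval (cont_algebra X) b (term_poly X s) x"
      define q where "q = poly_eval (cont_algebra X) b (term_poly X t) x"
      have "near_char X d1 b v" "near_char X d2 b v" using * near_char_mono by (metis min.cobounded1, metis min.cobounded2)
      then have "cmod (p - of_bool (x \<in> S)) < 1/8" "cmod (q - of_bool (x \<in> T)) < 1/8"
        using d(3,4) x by (auto simp: p_def q_def S_def T_def)
      moreover have "?f x - (of_bool (x \<in> S) - of_bool (x \<in> T)) = (p - of_bool (x \<in> S)) - (q - of_bool (x \<in> T))"
        using x by (simp add: P_def p_def q_def)
      ultimately show ?thesis
        using norm_triangle_ineq4[of "p - of_bool (x \<in> S)" "q - of_bool (x \<in> T)"] by (simp only:)
    qed
    show "cf_eval (cont_algebra X) b \<phi> = of_bool (\<not> ba_sat (clopen_algebra X) v (BEq s t))"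
    proof (cases "S = T")
      case True
      have "cs_norm (cont_algebra X) ?f \<le> 1/4"
        using close True by (subst cs_norm_cont_algebra_le_iff[OF X fc]) (auto intro: less_imp_le)
      then show ?thesis using True by (simp add: eval S_def T_def)
    next
      case False
      then obtain x where x: "x \<in> topspace X" "(x \<in> S) \<noteq> (x \<in> T)" using sub by blast
      have "1 = cmod (of_bool (x \<in> S) - of_bool (x \<in> T))" using x by auto
      also have "\<dots> \<le> cmod (?f x) + 1/4"
        using close[OF x(1)] norm_triangle_ineq3[of "?f x" "of_bool (x \<in> S) - of_bool (x \<in> T)"] by linarith
      also have "\<dots> \<le> cs_norm (cont_algebra X) ?f + 1/4"
        using cmod_le_cs_norm[OF X fc x(1)] by simp
      finally show ?thesis using False by (simp add: eval S_def T_def)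
    qed
  qed (use d in auto)
  then show ?thesis ..
qed

lemma translates_BNot:
  assumes "translates X \<phi> p"
  shows "translates X (CComb (\<lambda>x. 1 - x 0) [\<phi>]) (BNot p)"
proof -
  have [simp]: "cf_eval C b (CComb (\<lambda>x. 1 - x 0) [\<phi>]) = 1 - cf_eval C b \<phi>" for C b by simp
  obtain d where d: "d > 0" "\<And>b v. (\<forall>k. b k \<in> cs_ball (cont_algebra X) 1) \<Longrightarrow>
     (\<forall>k. v k \<in> ba_carrier (clopen_algebra X)) \<Longrightarrow> near_char X d b v \<Longrightarrow>
     cf_eval (cont_algebra X) b \<phi> = of_bool (\<not> ba_sat (clopen_algebra X) v p)"
    using assms(1) unfolding translates_def by blast
  show ?thesis
    unfolding translates_def
  proof (intro conjI exI[of _ d])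
    show "cf_wf (CComb (\<lambda>x. 1 - x 0) [\<phi>])" unfolding cf_wf.simps
      using assms by (intro conjI continuous_intros continuous_map_Euclidean_space_coord) (auto simp: translates_def)
  qed (use d assms in \<open>auto simp: translates_def simp del: cf_eval.simps One_nat_def\<close>)
qed

text \<open>As 0 stands for truth, conjunction is the maximum.\<close>

lemma translates_BAnd:
  assumes "translates X \<phi> p" "translates X \<psi> q"
  shows "translates X (CComb (\<lambda>x. max (x 0) (x 1)) [\<phi>, \<psi>]) (BAnd p q)"
proof -
  have [simp]: "cf_eval C b (CComb (\<lambda>x. max (x 0) (x 1)) [\<phi>, \<psi>]) = max (cf_eval C b \<phi>) (cf_eval C b \<psi>)" for C b by simp
  obtain d1 where d1: "d1 > 0" "\<And>b v. (\<forall>k. b k \<in> cs_ball (cont_algebra X) 1) \<Longrightarrow>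
     (\<forall>k. v k \<in> ba_carrier (clopen_algebra X)) \<Longrightarrow> near_char X d1 b v \<Longrightarrow>
     cf_eval (cont_algebra X) b \<phi> = of_bool (\<not> ba_sat (clopen_algebra X) v p)"
    using assms(1) unfolding translates_def by blast
  obtain d2 where d2: "d2 > 0" "\<And>b v. (\<forall>k. b k \<in> cs_ball (cont_algebra X) 1) \<Longrightarrow>
     (\<forall>k. v k \<in> ba_carrier (clopen_algebra X)) \<Longrightarrow> near_char X d2 b v \<Longrightarrow>
     cf_eval (cont_algebra X) b \<psi> = of_bool (\<not> ba_sat (clopen_algebra X) v q)"
    using assms(2) unfolding translates_def by blast
  have nr: "near_char X d1 b v" "near_char X d2 b v" if "near_char X (min d1 d2) b v" for b v
    using near_char_mono[OF that] by auto
  show ?thesis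
    unfolding translates_def
  proof (intro conjI exI[of _ "min d1 d2"])
    show "cf_wf (CComb (\<lambda>x. max (x 0) (x 1)) [\<phi>, \<psi>])" unfolding cf_wf.simps
      using assms by (intro conjI continuous_intros continuous_map_Euclidean_space_coord) (auto simp: translates_def)
    show "\<forall>b v. (\<forall>k. b k \<in> cs_ball (cont_algebra X) 1) \<and> (\<forall>k. v k \<in> ba_carrier (clopen_algebra X)) \<and>
        near_char X (min d1 d2) b v \<longrightarrow>
        cf_eval (cont_algebra X) b (CComb (\<lambda>x. max (x 0) (x 1)) [\<phi>, \<psi>]) = of_bool (\<not> ba_sat (clopen_algebra X) v (BAnd p q))"
      using d1(2) d2(2) nr by (auto simp del: cf_eval.simps One_nat_def clopen_algebra_sel)
    show "\<forall>b. (\<forall>k. b k \<in> cs_ball (cont_algebra X) 1) \<longrightarrow>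
       cf_eval (cont_algebra X) b (CComb (\<lambda>x. max (x 0) (x 1)) [\<phi>, \<psi>]) \<in> {0..1}"
    proof (intro allI impI)
      fix b :: "nat \<Rightarrow> 'a \<Rightarrow> complex" assume "\<forall>k. b k \<in> cs_ball (cont_algebra X) 1"
      then have "cf_eval (cont_algebra X) b \<phi> \<in> {0..1}" "cf_eval (cont_algebra X) b \<psi> \<in> {0..1}"
        using assms unfolding translates_def by blast+
      then show "cf_eval (cont_algebra X) b (CComb (\<lambda>x. max (x 0) (x 1)) [\<phi>, \<psi>]) \<in> {0..1}"
        by (simp add: le_max_iff_disj)
    qed
  qed (use d1 d2 assms in \<open>auto simp: translates_def simp del: cf_eval.simps One_nat_def\<close>)
qed

text \<open>A complex number with \<open>cnj z * z\<close> close to \<open>z\<close> is close to \<open>0\<close> or \<open>1\<close>, so a function with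
  \<open>proj_defect\<close> of small norm is close to the characteristic function of a clopen set.\<close>

definition proj_defect :: "nat \<Rightarrow> 'c star_poly" where
  "proj_defect k = PAdd (PMult (PStar (PVar k)) (PVar k)) (PScale (-1) (PVar k))"

lemma proj_defect_eval:
  "x \<in> topspace X \<Longrightarrow> poly_eval (cont_algebra X) b (proj_defect k) x = cnj (b k x) * b k x - b k x"
  by (simp add: proj_defect_def)

text \<open>The defect has modulus \<open>cmod (z - 1) * cmod z\<close>, so one of the factors is
  below \<open>e\<close>. As \<open>e \<le> 1/2\<close>, the real part then lies strictly on one
  side of 1/2.\<close>

lemma near_0_or_1:
  fixes z :: complex
  assumes "e > 0" "e \<le> 1/2" "cmod (cnj z * z - z) < e\<^sup>2"
  shows "cmod (z - of_bool (Re z > 1/2)) < e" "Re z \<noteq> 1/2"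
proof -
  have "cnj z * z - z = cnj (z - 1) * z" by (simp add: algebra_simps)
  then have *: "cmod (z - 1) * cmod z < e * e"
    using assms(3) by (metis complex_mod_cnj norm_mult power2_eq_square)
  have "cmod z < e \<or> cmod (z - 1) < e"
  proof (rule ccontr)
    assume "\<not> ?thesis"
    then have "e * e \<le> cmod (z - 1) * cmod z" using assms(1) by (intro mult_mono) auto
    then show False using * by simp
  qed
  moreover have "\<bar>Re z\<bar> \<le> cmod z" "\<bar>Re z - 1\<bar> \<le> cmod (z - 1)"
    using abs_Re_le_cmod[of z] abs_Re_le_cmod[of "z - 1"] by auto
  ultimately show "cmod (z - of_bool (Re z > 1/2)) < e" "Re z \<noteq> 1/2"
    using assms(2) by auto
qed


lemma proj_defect_clopen_char:
  assumes "b k = clopen_char X U"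
  shows "cs_norm (cont_algebra X) (poly_eval (cont_algebra X) b (proj_defect k)) = 0"
proof -
  define f where "f = poly_eval (cont_algebra X) b (proj_defect k)"
  have "cmod (f x) = 0" if "x \<in> topspace X" for x
    using that assms by (simp add: f_def proj_defect_eval clopen_char_def)
  then have "(SUP x\<in>topspace X. cmod (f x)) = (SUP x\<in>topspace X. 0)"
    by (intro SUP_cong) auto
  then show ?thesis
    by (simp add: cs_norm_cont_algebra flip: f_def)
qed

text \<open>Since the real part never equals 1/2, the strict and the weak inequality define the same
  set: one shows that it is open, the other that it is closed.\<close>

lemma proj_defect_small:
  assumes X: "compact_space X" and b: "\<forall>k. b k \<in> cs_carrier (cont_algebra X)"
    and e: "0 < e" "e \<le> 1/2"
    and small: "cs_norm (cont_algebra X) (poly_eval (cont_algebra X) b (proj_defect k)) < e\<^sup>2"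
  defines "U \<equiv> {x \<in> topspace X. Re (b k x) > 1/2}"
  shows "openin X U" "closedin X U" "\<forall>x\<in>topspace X. cmod (b k x - of_bool (x \<in> U)) < e"
proof -
  have "poly_eval (cont_algebra X) b (proj_defect k) \<in> cs_carrier (cont_algebra X)"
    using b by (intro poly_eval_in_carrier) (auto simp: proj_defect_def)
  then have cont: "continuous_map X euclidean (poly_eval (cont_algebra X) b (proj_defect k))"
    by simp
  have "cmod (cnj (b k x) * b k x - b k x) < e\<^sup>2" if "x \<in> topspace X" for x
    using cmod_le_cs_norm[OF X cont that] small that by (simp add: proj_defect_eval)
  then have *: "cmod (b k x - of_bool (Re (b k x) > 1/2)) < e" "Re (b k x) \<noteq> 1/2"
    if "x \<in> topspace X" for x
    using near_0_or_1[OF e] that by blast+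
  have "continuous_map X euclidean (b k)" using b by simp
  then have Re: "continuous_map X euclideanreal (\<lambda>x. Re (b k x))"
    unfolding continuous_map_atin limitin_canonical_iff by (auto intro!: tendsto_intros)
  from openin_continuous_map_preimage[OF Re, of "{1/2<..}"]
  show "openin X U" by (simp add: U_def)
  have "closedin X {x \<in> topspace X. Re (b k x) \<in> {1/2..}}"
    by (rule closedin_continuous_map_preimage[OF Re]) simp
  moreover have "{x \<in> topspace X. Re (b k x) \<in> {1/2..}} = U"
    using *(2) by (force simp: U_def)
  ultimately show "closedin X U" by simp
  show "\<forall>x\<in>topspace X. cmod (b k x - of_bool (x \<in> U)) < e"
    using *(1) by (auto simp: U_def)
qed

text \<open>The infimum ranges over the whole ball, so functions that are not close to projections
  have to be penalized. A defect of at least \<open>e\<^sup>2\<close> forces the value 1; a smaller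
  one puts the function within \<open>e \<le> d\<close> of a projection, where \<open>\<phi>\<close>
  has its exact value. Thus either a projection gives 0 or every value is 1.\<close>

lemma translates_BEx:
  assumes X: "compact_space X" and "translates X \<phi> p"
  shows "\<exists>\<psi>. translates X \<psi> (BEx k p)"
proof -
  let ?C = "cont_algebra X" and ?B = "clopen_algebra X"
  obtain d where d: "d > 0" "\<And>b v. (\<forall>k. b k \<in> cs_ball ?C 1) \<Longrightarrow>
     (\<forall>k. v k \<in> ba_carrier ?B) \<Longrightarrow> near_char X d b v \<Longrightarrow>
     cf_eval ?C b \<phi> = of_bool (\<not> ba_sat ?B v p)"
    using assms(2) unfolding translates_def by blast
  have \<phi>01: "cf_eval ?C b \<phi> \<in> {0..1}" if "\<forall>k. b k \<in> cs_ball ?C 1" for b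
    using assms(2) that unfolding translates_def by blast
  define e where "e = min d (1/2)"
  have e: "0 < e" "e \<le> 1/2" "e \<le> d" using d by (auto simp: e_def)
  define \<psi> :: "('a \<Rightarrow> complex) cformula"
    where "\<psi> = CComb (\<lambda>x. max (x 0) (min 1 (x 1 / e\<^sup>2))) [\<phi>, CNorm (proj_defect k)]"
  define def where "def b = cs_norm ?C (poly_eval ?C b (proj_defect k))" for b
  have \<psi>: "cf_eval ?C b \<psi> = max (cf_eval ?C b \<phi>) (min 1 (def b / e\<^sup>2))" for b
    by (simp add: \<psi>_def def_def)
  have upd: "\<forall>j. (b(k := a)) j \<in> cs_ball ?C 1" if "\<forall>k. b k \<in> cs_ball ?C 1" "a \<in> cs_ball ?C 1" for a b
    using that by simp
  have \<psi>01: "cf_eval ?C b \<psi> \<in> {0..1}" if "\<forall>k. b k \<in> cs_ball ?C 1" for b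
    using \<phi>01[OF that] by (simp add: \<psi> le_max_iff_disj)
  have \<psi>01': "cf_eval ?C (b(k := a)) \<psi> \<in> {0..1}"
    if "\<forall>k. b k \<in> cs_ball ?C 1" "a \<in> cs_ball ?C 1" for a b
    by (rule \<psi>01[OF upd[OF that]])
  have eval: "cf_eval ?C b (CInf 1 k \<psi>) = (INF a\<in>cs_ball ?C 1. cf_eval ?C (b(k := a)) \<psi>)" for b
    by simp
  \<comment> \<open>The zero function makes the ball nonempty; the real infimum over an empty set
    would be unspecified.\<close>
  have ne: "clopen_char X {} \<in> cs_ball ?C 1"
    by (intro clopen_char_in_ball X) auto
  have bdd: "bdd_below ((\<lambda>a. cf_eval ?C (b(k := a)) \<psi>) ` cs_ball ?C 1)" if "\<forall>k. b k \<in> cs_ball ?C 1" for b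
    using \<psi>01'[OF that] by (intro bdd_belowI[of _ 0]) (auto simp del: fun_upd_apply)
  have "translates X (CInf 1 k \<psi>) (BEx k p)"
    unfolding translates_def
  proof (intro conjI allI impI exI[of _ d])
    show "cf_wf (CInf 1 k \<psi>)" unfolding \<psi>_def cf_wf.simps
      using assms(2) e
      by (intro conjI continuous_intros continuous_map_Euclidean_space_coord) (auto simp: translates_def)
    show "set_cformula (CInf 1 k \<psi>) \<subseteq> cs_ball ?C 1"
      using assms(2) by (auto simp: \<psi>_def translates_def proj_defect_def)
    fix b :: "nat \<Rightarrow> 'a \<Rightarrow> complex" assume b: "\<forall>k. b k \<in> cs_ball ?C 1"
    have "0 \<le> (INF a\<in>cs_ball ?C 1. cf_eval ?C (b(k := a)) \<psi>)"
      using ne \<psi>01'[OF b] by (intro cINF_greatest) (auto simp del: fun_upd_apply One_nat_def)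
    moreover have "(INF a\<in>cs_ball ?C 1. cf_eval ?C (b(k := a)) \<psi>) \<le> 1"
      using \<psi>01'[OF b ne] by (intro cINF_lower2[OF bdd[OF b] ne]) auto
    ultimately show "cf_eval ?C b (CInf 1 k \<psi>) \<in> {0..1}" unfolding eval by simp
  next
    fix b v assume *: "(\<forall>k. b k \<in> cs_ball ?C 1) \<and> (\<forall>k. v k \<in> ba_carrier ?B) \<and> near_char X d b v"
    then have b: "\<forall>k. b k \<in> cs_ball ?C 1" by blast
    have dd: "cf_eval ?C (b(k := a)) \<phi> = of_bool (\<not> ba_sat ?B (v(k := U)) p)"
      if "a \<in> cs_ball ?C 1" "U \<in> ba_carrier ?B" "near_char X d (b(k := a)) (v(k := U))" for a U
      using that * by (intro d(2)) auto
    show "cf_eval ?C b (CInf 1 k \<psi>) = of_bool (\<not> ba_sat ?B v (BEx k p))"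
    proof (cases "ba_sat ?B v (BEx k p)")
      case True
      then obtain U where U: "U \<in> ba_carrier ?B" "ba_sat ?B (v(k := U)) p" by auto
      define a where "a = clopen_char X U"
      have a: "a \<in> cs_ball ?C 1" using U X by (simp add: a_def clopen_char_in_ball del: One_nat_def)
      have "near_char X d (b(k := a)) (v(k := U))"
        using * d(1) by (auto simp: near_char_def a_def clopen_char_def)
      then have "cf_eval ?C (b(k := a)) \<phi> = 0"
        using dd[OF a U(1)] U(2) by simp
      moreover have "def (b(k := a)) = 0"
        unfolding def_def by (intro proj_defect_clopen_char[where U = U]) (simp add: a_def)
      ultimately have "cf_eval ?C (b(k := a)) \<psi> = 0" by (simp add: \<psi>)
      then have "(INF a\<in>cs_ball ?C 1. cf_eval ?C (b(k := a)) \<psi>) \<le> 0"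
        by (intro cINF_lower2[OF bdd[OF b] a]) auto
      moreover have "0 \<le> (INF a\<in>cs_ball ?C 1. cf_eval ?C (b(k := a)) \<psi>)"
        using ne \<psi>01'[OF b] by (intro cINF_greatest) (auto simp del: fun_upd_apply One_nat_def)
      ultimately show ?thesis using True by (simp only: eval of_bool_def) simp
    next
      case False
      have "cf_eval ?C (b(k := a)) \<psi> = 1" if a: "a \<in> cs_ball ?C 1" for a
      proof (cases "def (b(k := a)) < e\<^sup>2")
        case True
        define U where "U = {x \<in> topspace X. Re ((b(k := a)) k x) > 1/2}"
        have "\<forall>j. (b(k := a)) j \<in> cs_carrier ?C" using upd[OF b a] unfolding cs_ball_def by blast
        note U = proj_defect_small[OF X this e(1,2) True[unfolded def_def], folded U_def]
        have "near_char X d (b(k := a)) (v(k := U))"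
          using * U(3) e(3) by (force simp: near_char_def)
        then have "cf_eval ?C (b(k := a)) \<phi> = of_bool (\<not> ba_sat ?B (v(k := U)) p)"
          using dd[OF a] U(1,2) by simp
        moreover have "\<not> ba_sat ?B (v(k := U)) p" using False U(1,2) by auto
        ultimately show ?thesis by (simp add: \<psi>)
      next
        case False
        then have "min 1 (def (b(k := a)) / e\<^sup>2) = 1" using e by simp
        then show ?thesis using \<phi>01[of "b(k := a)", OF upd[OF b a]] unfolding \<psi> by auto
      qed
      then have "(INF a\<in>cs_ball ?C 1. cf_eval ?C (b(k := a)) \<psi>) = (INF a\<in>cs_ball ?C 1. 1)"
        by (intro INF_cong) auto
      also have "\<dots> = 1" using ne by (intro cINF_const) auto
      finally show ?thesis using False by (simp only: eval of_bool_def) simp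
    qed
  qed (use d in auto)
  then show ?thesis ..
qed

lemma ex_translates:
  assumes X: "compact_space X" and "set_ba_formula p \<subseteq> ba_carrier (clopen_algebra X)"
  shows "\<exists>\<phi>. translates X \<phi> p"
  using assms(2)
proof (induction p)
  case (BEq s t)
  then show ?case by (intro translates_BEq[OF X]) auto
next
  case (BNot p)
  then show ?case by (auto intro: translates_BNot)
next
  case (BAnd p q)
  then obtain \<phi> \<psi> where "translates X \<phi> p" "translates X \<psi> q" by auto
  then show ?case using translates_BAnd by blast
next
  case (BOr p q)
  then obtain \<phi> \<psi> where "translates X \<phi> p" "translates X \<psi> q" by auto
  then have "translates X (CComb (\<lambda>x. 1 - x 0) [CComb (\<lambda>x. max (x 0) (x 1))
      [CComb (\<lambda>x. 1 - x 0) [\<phi>], CComb (\<lambda>x. 1 - x 0) [\<psi>]]]) (BNot (BAnd (BNot p) (BNot q)))"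
    by (intro translates_BNot translates_BAnd)
  then have "translates X (CComb (\<lambda>x. 1 - x 0) [CComb (\<lambda>x. max (x 0) (x 1))
      [CComb (\<lambda>x. 1 - x 0) [\<phi>], CComb (\<lambda>x. 1 - x 0) [\<psi>]]]) (BOr p q)"
    by (rule translates_cong) simp
  then show ?case ..
next
  case (BEx k p)
  then show ?case using translates_BEx[OF X] by auto
next
  case (BAll k p)
  then obtain \<phi> where "translates X \<phi> p" by auto
  then obtain \<psi> where "translates X \<psi> (BEx k (BNot p))"
    using translates_BNot translates_BEx[OF X] by blast
  then have "translates X (CComb (\<lambda>x. 1 - x 0) [\<psi>]) (BNot (BEx k (BNot p)))"
    by (rule translates_BNot)
  then have "translates X (CComb (\<lambda>x. 1 - x 0) [\<psi>]) (BAll k p)"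
    by (rule translates_cong) auto
  then show ?case ..
qed

text \<open>Translate the type into continuous conditions with value 0 and add conditions that every
  variable is a projection. Solutions of finite parts give exact solutions by characteristic
  functions, and thresholding a realization at 1/2 gives clopen sets that satisfy the type.\<close>

theorem ba_countably_saturated_clopen_algebra:
  assumes X: "compact_space X" and sat: "cs_countably_saturated (cont_algebra X)"
  shows "ba_countably_saturated (clopen_algebra X)"
  unfolding ba_countably_saturated_def
proof (intro allI impI, elim conjE)
  let ?C = "cont_algebra X" and ?B = "clopen_algebra X"
  fix T assume T: "countable T" "\<forall>p\<in>T. set_ba_formula p \<subseteq> ba_carrier ?B"
    and fin: "\<forall>S\<subseteq>T. finite S \<longrightarrow> (\<exists>v. (\<forall>k. v k \<in> ba_carrier ?B) \<and> (\<forall>p\<in>S. ba_sat ?B v p))"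
  show "\<exists>v. (\<forall>k. v k \<in> ba_carrier ?B) \<and> (\<forall>p\<in>T. ba_sat ?B v p)"
  proof (cases "T = {}")
    \<comment> \<open>The empty type is separated because \<open>from_nat_into T\<close> enumerates
      \<open>T\<close> only if \<open>T\<close> is nonempty.\<close>
    case True
    then show ?thesis using fin by blast
  next
    case False
    define p where "p = from_nat_into T"
    have rp: "range p = T" using T(1) False by (simp add: p_def range_from_nat_into)
    have "\<forall>n. \<exists>\<phi>. translates X \<phi> (p n)"
      using ex_translates[OF X] T(2) rp by blast
    then obtain \<phi> where \<phi>: "\<And>n. translates X (\<phi> n) (p n)" by metis
    \<comment> \<open>Even indices carry the translated type, odd indices the projection conditions
      for all variables.\<close>
    define \<theta> where "\<theta> n = (if even n then \<phi> (n div 2) else CNorm (proj_defect (n div 2)))" for n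
    have near0: "near_char X d (\<lambda>k. clopen_char X (v k)) v" if "d > 0" for d v
      using that by (auto simp: near_char_def clopen_char_def)
    have exact: "cf_eval ?C (\<lambda>k. clopen_char X (v k)) (\<phi> n) = of_bool (\<not> ba_sat ?B v (p n))"
      if v: "\<forall>k. v k \<in> ba_carrier ?B" for v n
    proof -
      have c: "\<forall>k. clopen_char X (v k) \<in> cs_ball ?C 1"
        using v X by (auto intro: clopen_char_in_ball simp del: One_nat_def)
      obtain d where d: "d > 0" "\<And>b v. (\<forall>k. b k \<in> cs_ball ?C 1) \<Longrightarrow>
         (\<forall>k. v k \<in> ba_carrier ?B) \<Longrightarrow> near_char X d b v \<Longrightarrow>
         cf_eval ?C b (\<phi> n) = of_bool (\<not> ba_sat ?B v (p n))"
        using \<phi>[of n] unfolding translates_def by blast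
      show ?thesis by (rule d(2)[OF c v near0[OF d(1)]])
    qed
    have "\<exists>b. (\<forall>k. b k \<in> cs_ball ?C 1) \<and> (\<forall>n. cf_eval ?C b (\<theta> n) \<in> {0})"
    proof (rule sat[unfolded cs_countably_saturated_def cs_countably_saturated_for_def, rule_format], intro conjI allI impI)
      fix n show "\<theta> n \<in> {\<phi>. cf_wf \<phi>}" "set_cformula (\<theta> n) \<subseteq> cs_ball ?C 1"
        using \<phi>[of "n div 2"] by (auto simp: \<theta>_def translates_def proj_defect_def)
    next
      fix e :: real and F :: "nat set" assume "e > 0" "finite F"
      then obtain v where v: "\<forall>k. v k \<in> ba_carrier ?B" "\<forall>q\<in>(\<lambda>n. p (n div 2)) ` F. ba_sat ?B v q"
        using fin[rule_format, of "(\<lambda>n. p (n div 2)) ` F"] rp by blast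
      let ?b = "\<lambda>k. clopen_char X (v k)"
      have b: "\<forall>k. ?b k \<in> cs_ball ?C 1"
        using v X by (auto intro: clopen_char_in_ball simp del: One_nat_def)
      have "cf_eval ?C ?b (\<theta> n) = 0" if "n \<in> F" for n
      proof (cases "even n")
        case True
        then show ?thesis using exact[OF v(1)] v(2) that by (simp add: \<theta>_def)
      next
        case False
        have "cs_norm ?C (poly_eval ?C ?b (proj_defect (n div 2))) = 0"
          by (intro proj_defect_clopen_char) simp
        then show ?thesis using False by (simp add: \<theta>_def)
      qed
      then show "\<exists>b. (\<forall>k. b k \<in> cs_ball ?C 1) \<and> (\<forall>n\<in>F. cf_eval ?C b (\<theta> n) \<in> thicken {0} e)"
        using b \<open>e > 0\<close> by (intro exI[of _ ?b]) (auto simp: thicken_def)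
    qed auto
    then obtain b where b: "\<And>k. b k \<in> cs_ball ?C 1" "\<And>n. cf_eval ?C b (\<theta> n) = 0" by auto
    define v where "v k = {x \<in> topspace X. Re (b k x) > 1/2}" for k
    have bc: "\<forall>k. b k \<in> cs_carrier ?C" using b(1) by (auto simp: cs_ball_def)
    have defect: "cs_norm ?C (poly_eval ?C b (proj_defect k)) = 0" for k
      using b(2)[of "2 * k + 1"] by (simp add: \<theta>_def)
    have v: "openin X (v k)" "closedin X (v k)"
      "\<forall>x\<in>topspace X. cmod (b k x - of_bool (x \<in> v k)) < e" if "0 < e" "e \<le> 1/2" for e k
      using proj_defect_small[OF X bc that, of k, folded v_def] defect[of k] that by auto
    \<comment> \<open>The defects vanish exactly, so the distance to the characteristic functions is
      below every bound; the minimum respects the restriction \<open>e \<le> 1/2\<close>.\<close>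
    have "near_char X d b v" if "d > 0" for d
      using v(3)[of "min d (1/2)"] that unfolding near_char_def by fastforce
    moreover have vc: "\<forall>k. v k \<in> ba_carrier ?B" using v(1,2)[of "1/2"] by simp
    ultimately have "cf_eval ?C b (\<phi> n) = of_bool (\<not> ba_sat ?B v (p n))" for n
      using \<phi>[of n] b(1) unfolding translates_def by blast
    then have "ba_sat ?B v (p n)" for n
      using b(2)[of "2 * n"] by (simp add: \<theta>_def)
    then show ?thesis using vc rp by blast
  qed
qed



section \<open>Coding continuous functions by sequences of clopen sets\<close>

text \<open>The weights sum to 1, so values lie in [-1, 1]. Since the ratio 2/3 exceeds 1/2,
  expansions overlap: between -1/3 and 1/3 either first sign is possible, which leaves room to
  choose a clopen set.\<close>

definition digit_sum :: "(nat \<Rightarrow> bool) \<Rightarrow> real" where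
  "digit_sum D = (\<Sum>j. (1/3) * (2/3) ^ j * (if D j then 1 else -1))"

lemma summable_digits: "summable (\<lambda>j. (1/3) * (2/3) ^ j * (if D j then 1 else -1 :: real))"
  by (rule summable_comparison_test'[where g = "\<lambda>j. (2/3) ^ j"]) (auto simp: abs_mult)

lemma abs_digit_sum_le: "\<bar>digit_sum D\<bar> \<le> 1"
proof -
  have s: "(\<lambda>j. (1/3) * (2/3) ^ j :: real) sums 1"
    using sums_mult[OF geometric_sums[of "2/3::real"], of "1/3"] by simp
  have "digit_sum D \<le> (\<Sum>j. (1/3) * (2/3) ^ j)"
    unfolding digit_sum_def by (intro suminf_le summable_digits sums_summable[OF s]) auto
  moreover have "(\<Sum>j. - ((1/3) * (2/3) ^ j)) \<le> digit_sum D"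
    unfolding digit_sum_def by (intro suminf_le summable_digits summable_minus sums_summable[OF s]) auto
  ultimately show ?thesis
    using s sums_minus[OF s] by (simp add: sums_iff)
qed

lemma digit_sum_split:
  "digit_sum D = (\<Sum>j<n. (1/3) * (2/3) ^ j * (if D j then 1 else -1)) + (2/3) ^ n * digit_sum (\<lambda>j. D (j + n))"
proof -
  have "digit_sum D = (\<Sum>j. (2/3) ^ n * ((1/3) * (2/3) ^ j * (if D (j + n) then 1 else -1)))
      + (\<Sum>j<n. (1/3) * (2/3) ^ j * (if D j then 1 else -1))"
    unfolding digit_sum_def suminf_split_initial_segment[OF summable_digits, of D n]
    by (simp add: power_add mult_ac)
  then show ?thesis
    unfolding digit_sum_def by (subst (asm) suminf_mult[OF summable_digits]) simp
qed

lemma digit_sum_partial: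
  "\<bar>digit_sum D - (\<Sum>j<n. (1/3) * (2/3) ^ j * (if D j then 1 else -1))\<bar> \<le> (2/3) ^ n"
  by (subst digit_sum_split[of D n])
    (use abs_digit_sum_le in \<open>simp add: abs_mult mult_left_le\<close>)

lemma digit_sum_agree:
  assumes "\<And>j. j < n \<Longrightarrow> D j = E j"
  shows "\<bar>digit_sum D - digit_sum E\<bar> \<le> 2 * (2/3) ^ n"
proof -
  have "(\<Sum>j<n. (1/3) * (2/3) ^ j * (if D j then 1 else -1)) =
      (\<Sum>j<n. (1/3) * (2/3) ^ j * (if E j then 1 else -1 :: real))"
    using assms by (intro sum.cong) auto
  then show ?thesis
    using digit_sum_partial[of D n] digit_sum_partial[of E n] by linarith
qed

text \<open>Partial sums are finite combinations of characteristic functions of clopen sets, and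
  they converge uniformly at the geometric rate of the tails.\<close>

lemma continuous_map_digit_sum:
  assumes "\<And>j. openin X (V j)" "\<And>j. closedin X (V j)"
  shows "continuous_map X euclideanreal (\<lambda>x. digit_sum (\<lambda>j. x \<in> V j))"
proof -
  define f where "f n x = (\<Sum>j<n. (1/3) * (2/3) ^ j * (2 * of_bool (x \<in> V j) - 1 :: real))" for n x
  have f: "f n x = (\<Sum>j<n. (1/3) * (2/3) ^ j * (if x \<in> V j then 1 else -1))" for n x
    unfolding f_def by (intro sum.cong) auto
  have "continuous_map X (mtopology_of euclidean_metric) (\<lambda>x. digit_sum (\<lambda>j. x \<in> V j))"
    unfolding mtopology_of_def
  proof (rule Metric_space.continuous_map_uniform_limit_alt[where F = sequentially and f = f])
    show "\<forall>\<^sub>F n in sequentially. continuous_map X (Metric_space.mtopology (mspace euclidean_metric) (mdist euclidean_metric)) (f n)"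
      unfolding f_def using continuous_map_of_bool_clopen[OF assms, where 'b = real]
      by (intro always_eventually allI) (auto intro!: continuous_intros simp flip: mtopology_of_def)
    fix e :: real assume "e > 0"
    have "(\<lambda>n. (2/3::real) ^ n) \<longlonglongrightarrow> 0" by (intro LIMSEQ_realpow_zero) auto
    then have "\<forall>\<^sub>F n in sequentially. (2/3::real) ^ n < e"
      using \<open>e > 0\<close> by (rule order_tendstoD)
    then show "\<forall>\<^sub>F n in sequentially. \<forall>x\<in>topspace X. mdist euclidean_metric (f n x) (digit_sum (\<lambda>j. x \<in> V j)) < e"
    proof eventually_elim
      case (elim n)
      then show ?case
        using digit_sum_partial[of "\<lambda>j. _ \<in> V j" n] by (auto simp: f dist_real_def abs_minus_commute intro: le_less_trans)
    qed
  qed (auto simp: Met_TC.Metric_space_axioms)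
  then show ?thesis by simp
qed

text \<open>Clopen subsets of \<open>W\<close> cover the compact set \<open>K\<close>; a finite
  subcover has a clopen union.\<close>

lemma ex_clopen_between:
  assumes X: "compact_space X" "zero_dimensional_space X"
    and "closedin X K" "openin X W" "K \<subseteq> W"
  shows "\<exists>V. openin X V \<and> closedin X V \<and> K \<subseteq> V \<and> V \<subseteq> W"
proof -
  define \<U> where "\<U> = {V. openin X V \<and> closedin X V \<and> V \<subseteq> W}"
  have "compactin X K" using X(1) assms(3) by (simp add: closedin_compact_space)
  moreover have "K \<subseteq> \<Union>\<U>"
    using X(2) assms(4,5) unfolding zero_dimensional_space_def \<U>_def by blast
  ultimately obtain \<F> where "finite \<F>" "\<F> \<subseteq> \<U>" "K \<subseteq> \<Union>\<F>"
    using compactinD[of X K \<U>] by (auto simp: \<U>_def)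
  then show ?thesis
    by (intro exI[of _ "\<Union>\<F>"]) (auto simp: \<U>_def intro!: closedin_Union)
qed

text \<open>Greedy expansion: if \<open>\<bar>u\<bar> \<le> 1\<close> and the clopen set \<open>V\<close> lies between \<open>{u \<ge> 1/3}\<close> and
  \<open>{u > -1/3}\<close>, then \<open>u\<close> differs from \<open>\<plusminus>1/3\<close>, with sign given by \<open>V\<close>, by at most \<open>2/3\<close>.\<close>

lemma ex_digits:
  fixes t :: "'a \<Rightarrow> real"
  assumes X: "compact_space X" "zero_dimensional_space X"
    and t: "continuous_map X euclideanreal t" "\<And>x. x \<in> topspace X \<Longrightarrow> \<bar>t x\<bar> \<le> 1"
  shows "\<exists>V. (\<forall>j. openin X (V j) \<and> closedin X (V j)) \<and>
    (\<forall>x\<in>topspace X. t x = digit_sum (\<lambda>j. x \<in> V j))"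
proof -
  define between where "between u V \<longleftrightarrow> openin X V \<and> closedin X V \<and>
    {x \<in> topspace X. u x \<ge> 1/3} \<subseteq> V \<and> V \<subseteq> {x \<in> topspace X. u x > -1/3}" for u :: "'a \<Rightarrow> real" and V
  define cut where "cut u = (SOME V. between u V)" for u
  have cut: "between u (cut u)" if "continuous_map X euclideanreal u" for u
  proof -
    have "closedin X {x \<in> topspace X. u x \<in> {1/3..}}"
      by (rule closedin_continuous_map_preimage[OF that]) simp
    moreover have "openin X {x \<in> topspace X. u x \<in> {-1/3<..}}"
      by (rule openin_continuous_map_preimage[OF that]) simp
    ultimately have "\<exists>V. between u V"
      using ex_clopen_between[OF X, of "{x \<in> topspace X. u x \<in> {1/3..}}" "{x \<in> topspace X. u x \<in> {-1/3<..}}"]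
      by (force simp: between_def)
    then show ?thesis unfolding cut_def by (rule someI_ex)
  qed
  \<comment> \<open>The factor 3/2 rescales the remainder back into [-1, 1], so that the same choice
    can be repeated.\<close>
  define step where "step u = (\<lambda>x. (3/2) * (u x - (1/3) * (2 * of_bool (x \<in> cut u) - 1)))" for u
  define rem where "rem n = (step ^^ n) t" for n
  define V where "V n = cut (rem n)" for n
  have rem_0: "rem 0 = t" by (simp add: rem_def)
  have rem_Suc: "rem (Suc n) x = (3/2) * (rem n x - (1/3) * (2 * of_bool (x \<in> V n) - 1))" for n x
    by (simp add: rem_def step_def V_def)
  have inv: "continuous_map X euclideanreal (rem n) \<and> (\<forall>x\<in>topspace X. \<bar>rem n x\<bar> \<le> 1)" for n
  proof (induction n)
    case (Suc n)
    then have b: "between (rem n) (V n)" using cut by (simp add: V_def)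
    have "continuous_map X euclideanreal (rem (Suc n))"
      unfolding rem_Suc using Suc continuous_map_of_bool_clopen[of X "V n", where 'b = real] b
      by (auto simp: between_def intro!: continuous_intros)
    moreover have "\<bar>rem (Suc n) x\<bar> \<le> 1" if x: "x \<in> topspace X" for x
    proof (cases "x \<in> V n")
      case True
      then have "rem n x > -1/3" using b by (auto simp: between_def)
      moreover have "rem n x \<le> 1" using Suc x abs_le_D1 by blast
      ultimately show ?thesis using True by (simp add: rem_Suc abs_le_iff)
    next
      case False
      then have "rem n x < 1/3" using b x by (force simp: between_def)
      moreover have "rem n x \<ge> -1" using Suc x by (auto simp: abs_le_iff)
      ultimately show ?thesis using False by (simp add: rem_Suc abs_le_iff)
    qed
    ultimately show ?case by blast
  qed (use t in \<open>simp add: rem_0\<close>)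
  have part: "t x = (\<Sum>j<n. (1/3) * (2/3) ^ j * (if x \<in> V j then 1 else -1)) + (2/3) ^ n * rem n x" for n x
  proof (induction n)
    case (Suc n)
    have "(2/3) ^ n * rem n x = (1/3) * (2/3) ^ n * (if x \<in> V n then 1 else -1) + (2/3) ^ Suc n * rem (Suc n) x"
      by (simp add: rem_Suc field_simps)
    with Suc show ?case by simp
  qed (simp add: rem_0)
  have "t x = digit_sum (\<lambda>j. x \<in> V j)" if x: "x \<in> topspace X" for x
  proof -
    have lim0: "(\<lambda>n. (2/3::real) ^ n) \<longlonglongrightarrow> 0" by (intro LIMSEQ_realpow_zero) auto
    have "(\<lambda>n. (2/3) ^ n * rem n x) \<longlonglongrightarrow> 0"
      by (rule tendsto_rabs_zero_cancel, rule tendsto_sandwich[OF _ _ tendsto_const lim0])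
        (use inv x in \<open>auto simp: abs_mult mult_left_le\<close>)
    then have "(\<lambda>n. t x - (2/3) ^ n * rem n x) \<longlonglongrightarrow> t x - 0" by (intro tendsto_intros)
    moreover have "t x - (2/3) ^ n * rem n x = (\<Sum>j<n. (1/3) * (2/3) ^ j * (if x \<in> V j then 1 else -1))" for n
      using part[of x n] by simp
    ultimately have "(\<lambda>j. (1/3) * (2/3) ^ j * (if x \<in> V j then 1 else -1)) sums t x"
      by (simp add: sums_def)
    then show ?thesis by (simp add: digit_sum_def sums_iff)
  qed
  moreover have "openin X (V j) \<and> closedin X (V j)" for j
    using cut[of "rem j"] inv by (auto simp: between_def V_def)
  ultimately show ?thesis by blast
qed

text \<open>The values lie in a square that is larger than the unit disc, so decoding arbitrary
  clopen sets need not give an element of the unit ball.\<close>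

definition decode :: "(nat \<Rightarrow> bool) \<Rightarrow> complex" where
  "decode D = of_real (digit_sum (\<lambda>j. D (2 * j))) + \<i> * of_real (digit_sum (\<lambda>j. D (2 * j + 1)))"

lemma ex_code:
  fixes f :: "'a \<Rightarrow> complex"
  assumes X: "compact_space X" "zero_dimensional_space X"
    and f: "continuous_map X euclidean f" "\<And>x. x \<in> topspace X \<Longrightarrow> cmod (f x) \<le> 1"
  shows "\<exists>V. (\<forall>j. openin X (V j) \<and> closedin X (V j)) \<and>
    (\<forall>x\<in>topspace X. f x = decode (\<lambda>j. x \<in> V j))"
proof -
  have c: "continuous_map X euclideanreal (\<lambda>x. Re (f x))" "continuous_map X euclideanreal (\<lambda>x. Im (f x))"
    using f(1) unfolding continuous_map_atin limitin_canonical_iff by (auto intro!: tendsto_intros)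
  have "\<bar>Re (f x)\<bar> \<le> 1" "\<bar>Im (f x)\<bar> \<le> 1" if "x \<in> topspace X" for x
    using f(2)[OF that] abs_Re_le_cmod[of "f x"] abs_Im_le_cmod[of "f x"] by linarith+
  with ex_digits[OF X c(1)] ex_digits[OF X c(2)] obtain V W where
    V: "\<forall>j. openin X (V j) \<and> closedin X (V j)" "\<forall>x\<in>topspace X. Re (f x) = digit_sum (\<lambda>j. x \<in> V j)" and
    W: "\<forall>j. openin X (W j) \<and> closedin X (W j)" "\<forall>x\<in>topspace X. Im (f x) = digit_sum (\<lambda>j. x \<in> W j)"
    by blast
  define U where "U j = (if even j then V (j div 2) else W (j div 2))" for j
  have "f x = decode (\<lambda>j. x \<in> U j)" if "x \<in> topspace X" for x
    using V(2) W(2) that by (auto simp: decode_def U_def complex_eq_iff)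
  moreover have "openin X (U j) \<and> closedin X (U j)" for j using V W by (auto simp: U_def)
  ultimately show ?thesis by blast
qed

lemma continuous_map_decode:
  assumes "\<And>j. openin X (V j)" "\<And>j. closedin X (V j)"
  shows "continuous_map X euclidean (\<lambda>x. decode (\<lambda>j. x \<in> V j))"
proof -
  have "continuous_map X euclideanreal (\<lambda>x. digit_sum (\<lambda>j. x \<in> V (2 * j)))"
    "continuous_map X euclideanreal (\<lambda>x. digit_sum (\<lambda>j. x \<in> V (2 * j + 1)))"
    using assms by (auto intro: continuous_map_digit_sum)
  then show ?thesis
    unfolding continuous_map_atin limitin_canonical_iff decode_def by (auto intro!: tendsto_intros)
qed

lemma norm_decode_le: "cmod (decode D) \<le> 2"
proof -
  have "cmod (decode D) \<le> \<bar>digit_sum (\<lambda>j. D (2 * j))\<bar> + \<bar>digit_sum (\<lambda>j. D (2 * j + 1))\<bar>"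
    unfolding decode_def by (rule norm_triangle_le) (simp add: norm_mult)
  also have "\<dots> \<le> 1 + 1" by (intro add_mono abs_digit_sum_le)
  finally show ?thesis by simp
qed

text \<open>A given precision needs only finitely many digits, and once \<open>n\<close> exceeds
  their indices \<open>c j\<close>, truncating the pattern leaves them intact, whatever
  \<open>s\<close> is.\<close>

lemma uniform_limit_digit_sum:
  fixes c :: "nat \<Rightarrow> nat"
  shows "uniform_limit UNIV (\<lambda>n s. digit_sum (\<lambda>j. c j \<in> s \<inter> {..<n})) (\<lambda>s. digit_sum (\<lambda>j. c j \<in> s)) sequentially"
proof (rule uniform_limitI)
  fix e :: real assume "e > 0"
  have "(\<lambda>n. 2 * (2/3::real) ^ n) \<longlonglongrightarrow> 2 * 0" by (intro tendsto_intros LIMSEQ_realpow_zero) auto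
  then have "\<forall>\<^sub>F n in sequentially. 2 * (2/3::real) ^ n < e"
    by (rule order_tendstoD) (use \<open>e > 0\<close> in simp)
  then obtain N where N: "2 * (2/3::real) ^ N < e" by (auto simp: eventually_sequentially)
  have "\<forall>\<^sub>F n in sequentially. \<forall>j\<in>{..<N}. c j < n"
    by (intro eventually_ball_finite ballI eventually_gt_at_top) auto
  then show "\<forall>\<^sub>F n in sequentially. \<forall>s\<in>UNIV. dist (digit_sum (\<lambda>j. c j \<in> s \<inter> {..<n})) (digit_sum (\<lambda>j. c j \<in> s)) < e"
  proof eventually_elim
    case (elim n)
    show ?case
    proof
      fix s
      have "\<bar>digit_sum (\<lambda>j. c j \<in> s \<inter> {..<n}) - digit_sum (\<lambda>j. c j \<in> s)\<bar> \<le> 2 * (2/3) ^ N"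
        using elim by (intro digit_sum_agree) auto
      with N show "dist (digit_sum (\<lambda>j. c j \<in> s \<inter> {..<n})) (digit_sum (\<lambda>j. c j \<in> s)) < e"
        by (simp add: dist_real_def)
    qed
  qed
qed

lemma uniform_limit_decode:
  fixes c :: "nat \<Rightarrow> nat"
  shows "uniform_limit UNIV (\<lambda>n s. decode (\<lambda>j. c j \<in> s \<inter> {..<n})) (\<lambda>s. decode (\<lambda>j. c j \<in> s)) sequentially"
  unfolding decode_def
  by (intro uniform_limit_intros uniform_limit_digit_sum
      bounded_linear.uniform_limit[OF bounded_linear_of_real]
      bounded_linear.uniform_limit[OF bounded_linear_mult_right])

section \<open>Evaluation of polynomials on digit patterns\<close>

text \<open>A pattern \<open>s\<close> is the set of all digit indices that are on at a point.  Digit \<open>j\<close> of variable \<open>k\<close> has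
  index \<open>2 * prod_encode (k, j)\<close>, digit \<open>j\<close> of parameter \<open>a\<close> has index
  \<open>2 * prod_encode (ix a, j) + 1\<close>.\<close>

primrec pat_eval :: "('c \<Rightarrow> nat) \<Rightarrow> 'c star_poly \<Rightarrow> nat set \<Rightarrow> complex" where
  "pat_eval ix (PVar k) s = decode (\<lambda>j. 2 * prod_encode (k, j) \<in> s)"
| "pat_eval ix (PParam a) s = decode (\<lambda>j. 2 * prod_encode (ix a, j) + 1 \<in> s)"
| "pat_eval ix (PAdd P Q) s = pat_eval ix P s + pat_eval ix Q s"
| "pat_eval ix (PScale c P) s = c * pat_eval ix P s"
| "pat_eval ix (PMult P Q) s = pat_eval ix P s * pat_eval ix Q s"
| "pat_eval ix (PStar P) s = cnj (pat_eval ix P s)"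

lemma poly_eval_eq_pat_eval:
  assumes "x \<in> topspace X"
    and "\<And>k. b k x = decode (\<lambda>j. 2 * prod_encode (k, j) \<in> s)"
    and "\<And>a. a \<in> set_star_poly P \<Longrightarrow> a x = decode (\<lambda>j. 2 * prod_encode (ix a, j) + 1 \<in> s)"
  shows "poly_eval (cont_algebra X) b P x = pat_eval ix P s"
  using assms(3) by (induction P) (simp_all add: assms(1,2))

text \<open>Boundedness lets uniform limits pass to products and keeps the suprema of moduli
  finite.\<close>

lemma bounded_pat_eval: "bounded (range (pat_eval ix P))"
proof (induction P)
  case (PVar k)
  show ?case using norm_decode_le by (auto simp: bounded_iff)
next
  case (PParam a)
  show ?case using norm_decode_le by (auto simp: bounded_iff)
next
  case (PAdd P Q)
  then obtain B C where "\<And>s. cmod (pat_eval ix P s) \<le> B" "\<And>s. cmod (pat_eval ix Q s) \<le> C"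
    by (auto simp: bounded_iff)
  then show ?case
    by (auto simp: bounded_iff intro!: exI[of _ "B + C"] norm_triangle_le add_mono)
next
  case (PScale c P)
  then obtain B where "\<And>s. cmod (pat_eval ix P s) \<le> B" by (auto simp: bounded_iff)
  then show ?case
    by (auto simp: bounded_iff norm_mult intro!: exI[of _ "cmod c * B"] mult_left_mono)
next
  case (PMult P Q)
  then obtain B C where *: "\<And>s. cmod (pat_eval ix P s) \<le> B" "\<And>s. cmod (pat_eval ix Q s) \<le> C"
    by (auto simp: bounded_iff)
  have "cmod (pat_eval ix P s * pat_eval ix Q s) \<le> B * C" for s
    unfolding norm_mult using * order_trans[OF norm_ge_zero *(1)] by (intro mult_mono) auto
  then show ?case by (auto simp: bounded_iff)
next
  case (PStar P)
  then show ?case by (auto simp: bounded_iff)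
qed

lemma uniform_limit_pat_eval:
  "uniform_limit UNIV (\<lambda>n s. pat_eval ix P (s \<inter> {..<n})) (pat_eval ix P) sequentially"
proof (induction P)
  case (PVar k)
  show ?case using uniform_limit_decode[of "\<lambda>j. 2 * prod_encode (k, j)"] by simp
next
  case (PParam a)
  show ?case using uniform_limit_decode[of "\<lambda>j. 2 * prod_encode (ix a, j) + 1"] by simp
next
  case (PAdd P Q)
  then show ?case by (auto intro: uniform_limit_intros)
next
  case (PScale c P)
  then show ?case by (auto intro: bounded_linear.uniform_limit[OF bounded_linear_mult_right])
next
  case (PMult P Q)
  then show ?case using bounded_pat_eval[of ix] by (auto intro: uniform_lim_mult)
next
  case (PStar P)
  then show ?case by (auto intro: bounded_linear.uniform_limit[OF bounded_linear_cnj])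
qed

section \<open>Convergence of norms and quantifier-free formulas along patterns\<close>

lemma SUP_le_SUP_add:
  fixes f :: "'a \<Rightarrow> real" and g :: "'b \<Rightarrow> real"
  assumes "A \<noteq> {}" "bdd_above (g ` B)" "\<And>x. x \<in> A \<Longrightarrow> \<exists>y\<in>B. f x \<le> g y + e"
  shows "(SUP x\<in>A. f x) \<le> (SUP y\<in>B. g y) + e"
proof (rule cSUP_least[OF assms(1)])
  fix x assume "x \<in> A"
  with assms(3) obtain y where "y \<in> B" "f x \<le> g y + e" by blast
  with cSUP_upper[OF this(1) assms(2)] show "f x \<le> (SUP y\<in>B. g y) + e" by linarith
qed

text \<open>Up to a small error \<open>F\<close> sees only the pattern below some \<open>n\<close>.
  Once both sides show the same truncated patterns, every value under one supremum is nearly matched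
  under the other, possibly at a different point.\<close>

lemma tendsto_SUP_patterns:
  fixes F :: "nat set \<Rightarrow> complex"
  assumes "A \<noteq> {}" and bdd: "bounded (range F)"
    and unif: "uniform_limit UNIV (\<lambda>n s. F (s \<inter> {..<n})) F sequentially"
    and pat: "\<And>n. \<forall>\<^sub>F m in sequentially. (\<lambda>x. p m x \<inter> {..<n}) ` A = (\<lambda>x. q x \<inter> {..<n}) ` A"
  shows "(\<lambda>m. SUP x\<in>A. cmod (F (p m x))) \<longlonglongrightarrow> (SUP x\<in>A. cmod (F (q x)))"
proof (rule tendstoI)
  fix e :: real assume "e > 0"
  have bdd': "bdd_above ((\<lambda>x. cmod (F (h x))) ` A)" for h
    using bdd by (auto simp: bounded_iff bdd_above_def)
  from uniform_limitD[OF unif, of "e/4"] \<open>e > 0\<close> obtain n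
    where n: "\<And>s. dist (F (s \<inter> {..<n})) (F s) < e/4"
    by (auto simp: eventually_sequentially)
  have close: "cmod (F s) \<le> cmod (F t) + e/2" if "s \<inter> {..<n} = t \<inter> {..<n}" for s t
  proof -
    have "dist (F s) (F t) \<le> e/4 + e/4"
      using n[of s] n[of t] that dist_triangle2[of "F s" "F t" "F (s \<inter> {..<n})"] by (simp add: dist_commute)
    then show ?thesis
      using norm_triangle_sub[of "F s" "F t"] by (simp add: dist_norm)
  qed
  from pat[of n] show "\<forall>\<^sub>F m in sequentially. dist (SUP x\<in>A. cmod (F (p m x))) (SUP x\<in>A. cmod (F (q x))) < e"
  proof eventually_elim
    case (elim m)
    have "(SUP x\<in>A. cmod (F (p m x))) \<le> (SUP x\<in>A. cmod (F (q x))) + e/2"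
    proof (rule SUP_le_SUP_add[OF assms(1) bdd'])
      fix x assume "x \<in> A"
      then obtain y where "y \<in> A" "p m x \<inter> {..<n} = q y \<inter> {..<n}"
        using elim by (metis (no_types, lifting) image_iff)
      then show "\<exists>y\<in>A. cmod (F (p m x)) \<le> cmod (F (q y)) + e/2" using close by blast
    qed
    moreover have "(SUP x\<in>A. cmod (F (q x))) \<le> (SUP x\<in>A. cmod (F (p m x))) + e/2"
    proof (rule SUP_le_SUP_add[OF assms(1) bdd'])
      fix x assume "x \<in> A"
      then obtain y where "y \<in> A" "q x \<inter> {..<n} = p m y \<inter> {..<n}"
        using elim by (metis (no_types, lifting) image_iff)
      then show "\<exists>y\<in>A. cmod (F (q x)) \<le> cmod (F (p m y)) + e/2" using close by blast
    qed
    ultimately show ?case using \<open>e > 0\<close> by (simp add: dist_real_def)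
  qed
qed

text \<open>\<open>p m x\<close> and \<open>q x\<close> are the patterns at \<open>x\<close> of the assignments \<open>b m\<close> and \<open>c\<close>.\<close>

lemma tendsto_cf_eval_quantifier_free:
  assumes pat: "\<And>n. \<forall>\<^sub>F m in sequentially.
      (\<lambda>x. p m x \<inter> {..<n}) ` topspace X = (\<lambda>x. q x \<inter> {..<n}) ` topspace X"
    and b: "\<And>m k x. x \<in> topspace X \<Longrightarrow> b m k x = decode (\<lambda>j. 2 * prod_encode (k, j) \<in> p m x)"
    and c: "\<And>k x. x \<in> topspace X \<Longrightarrow> c k x = decode (\<lambda>j. 2 * prod_encode (k, j) \<in> q x)"
    and params: "\<And>a m x. a \<in> set_cformula \<phi> \<Longrightarrow> x \<in> topspace X \<Longrightarrow>
      a x = decode (\<lambda>j. 2 * prod_encode (ix a, j) + 1 \<in> p m x) \<and>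
      a x = decode (\<lambda>j. 2 * prod_encode (ix a, j) + 1 \<in> q x)"
    and "cf_wf \<phi>" "cf_quantifier_free \<phi>"
  shows "(\<lambda>m. cf_eval (cont_algebra X) (b m) \<phi>) \<longlonglongrightarrow> cf_eval (cont_algebra X) c \<phi>"
  using params \<open>cf_wf \<phi>\<close> \<open>cf_quantifier_free \<phi>\<close>
proof (induction \<phi>)
  case (CNorm P)
  show ?case
  proof (cases "topspace X = {}")
    case False
    have "poly_eval (cont_algebra X) (b m) P x = pat_eval ix P (p m x)"
      "poly_eval (cont_algebra X) c P x = pat_eval ix P (q x)" if "x \<in> topspace X" for m x
      using that CNorm.prems(1) by (auto intro!: poly_eval_eq_pat_eval b c)
    then have "cf_eval (cont_algebra X) (b m) (CNorm P) = (SUP x\<in>topspace X. cmod (pat_eval ix P (p m x)))"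
      "cf_eval (cont_algebra X) c (CNorm P) = (SUP x\<in>topspace X. cmod (pat_eval ix P (q x)))" for m
      using False by (auto simp: cs_norm_cont_algebra intro!: SUP_cong)
    then show ?thesis
      using tendsto_SUP_patterns[OF False bounded_pat_eval uniform_limit_pat_eval pat] by simp
  qed (simp add: cs_norm_cont_algebra)
next
  case (CComb f \<phi>s)
  let ?C = "cont_algebra X"
  \<comment> \<open>The argument of the connective as a point of \<open>Euclidean_space\<close>: its
    coordinates vanish beyond the length, and convergence is coordinatewise.\<close>
  define pt where "pt v = (\<lambda>i. if i < length \<phi>s then map (cf_eval ?C v) \<phi>s ! i else 0)" for v
  have "(\<lambda>m. cf_eval ?C (b m) (\<phi>s ! i)) \<longlonglongrightarrow> cf_eval ?C c (\<phi>s ! i)" if "i < length \<phi>s" for i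
  proof (rule CComb.IH)
    show "\<phi>s ! i \<in> set \<phi>s" "cf_wf (\<phi>s ! i)" "cf_quantifier_free (\<phi>s ! i)"
      using that CComb.prems by auto
    fix a m x assume "a \<in> set_cformula (\<phi>s ! i)" "x \<in> topspace X"
    then show "a x = decode (\<lambda>j. 2 * prod_encode (ix a, j) + 1 \<in> p m x) \<and>
      a x = decode (\<lambda>j. 2 * prod_encode (ix a, j) + 1 \<in> q x)"
      using that by (intro CComb.prems(1)) auto
  qed
  then have "limitin (Euclidean_space (length \<phi>s)) (\<lambda>m. pt (b m)) (pt c) sequentially"
    by (auto simp: Euclidean_space_def limitin_subtopology limitin_componentwise pt_def)
  moreover have "continuous_map (Euclidean_space (length \<phi>s)) euclideanreal f" using CComb.prems by simp
  ultimately have "limitin euclideanreal (f \<circ> (\<lambda>m. pt (b m))) (f (pt c)) sequentially"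
    by (rule continuous_map_limit[rotated])
  then show ?case by (simp add: pt_def o_def)
qed auto

section \<open>From classical to quantifier-free saturation\<close>

text \<open>The term for the atom that \<open>s\<close> selects among the Boolean combinations of
  the first \<open>n\<close> terms.\<close>

primrec pat_term :: "(nat \<Rightarrow> 'b ba_term) \<Rightarrow> nat \<Rightarrow> nat set \<Rightarrow> 'b ba_term" where
  "pat_term t 0 s = BOne"
| "pat_term t (Suc n) s = BMeet (pat_term t n s) (if n \<in> s then t n else BCompl (t n))"

lemma ba_eval_pat_term:
  "ba_eval (clopen_algebra X) v (pat_term t n s) =
     {x \<in> topspace X. {i. x \<in> ba_eval (clopen_algebra X) v (t i)} \<inter> {..<n} = s \<inter> {..<n}}"
proof -
  have "x \<in> ba_eval (clopen_algebra X) v (pat_term t n s) \<longleftrightarrow>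
      x \<in> topspace X \<and> (\<forall>i<n. x \<in> ba_eval (clopen_algebra X) v (t i) \<longleftrightarrow> i \<in> s)" for x
    by (induction n) (auto simp: less_Suc_eq)
  then show ?thesis by auto
qed

lemma set_pat_term: "set_ba_term (pat_term t n s) \<subseteq> (\<Union>i. set_ba_term (t i))"
  by (induction n) auto

text \<open>For a single \<open>q\<close>, the property holds infinitely often or fails infinitely
  often, so a subsequence decides it; diagonalization decides all \<open>q\<close> together.\<close>

lemma ex_subseq_eventually_constant:
  fixes R :: "nat \<Rightarrow> nat \<Rightarrow> bool"
  shows "\<exists>r. strict_mono r \<and> (\<forall>q. (\<forall>\<^sub>F m in sequentially. R q (r m)) \<or> (\<forall>\<^sub>F m in sequentially. \<not> R q (r m)))"
proof -
  define P where "P q s \<longleftrightarrow> (\<forall>m. R q (s m)) \<or> (\<forall>m. \<not> R q (s m))" for q and s :: "nat \<Rightarrow> nat"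
  interpret subseqs P
  proof
    fix q and s :: "nat \<Rightarrow> nat" assume "strict_mono s"
    show "\<exists>r'. strict_mono r' \<and> P q (s \<circ> r')"
    proof (cases "infinite {m. R q (s m)}")
      case True
      from infinite_enumerate[OF this] obtain r' :: "nat \<Rightarrow> nat"
        where "strict_mono r'" "\<forall>m. r' m \<in> {m. R q (s m)}" by blast
      then show ?thesis by (intro exI[of _ r']) (simp add: P_def)
    next
      case False
      moreover have "{m. \<not> R q (s m)} = - {m. R q (s m)}" by blast
      ultimately have "infinite {m. \<not> R q (s m)}" by (simp add: finite_compl)
      from infinite_enumerate[OF this] obtain r' :: "nat \<Rightarrow> nat"
        where "strict_mono r'" "\<forall>m. r' m \<in> {m. \<not> R q (s m)}" by blast
      then show ?thesis by (intro exI[of _ r']) (simp add: P_def)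
    qed
  qed
  have P: "P q (diagseq \<circ> ((+) (Suc q)))" for q
    by (rule diagseq_holds) (auto simp: P_def)
  have "(\<forall>\<^sub>F m in sequentially. R q (diagseq m)) \<or> (\<forall>\<^sub>F m in sequentially. \<not> R q (diagseq m))" for q
  proof -
    have "(\<forall>m. R q (diagseq (m + Suc q))) \<or> (\<forall>m. \<not> R q (diagseq (m + Suc q)))"
      using P[of q] by (simp add: P_def add.commute)
    then have "(\<forall>\<^sub>F m in sequentially. R q (diagseq (m + Suc q))) \<or>
        (\<forall>\<^sub>F m in sequentially. \<not> R q (diagseq (m + Suc q)))"
      by (auto intro: always_eventually)
    then show ?thesis
      by (simp only: eventually_sequentially_seg[of "\<lambda>m. R q (diagseq m)"]
          eventually_sequentially_seg[of "\<lambda>m. \<not> R q (diagseq m)"])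
  qed
  then show ?thesis using subseq_diagseq by blast
qed

text \<open>Allows the parameters of all conditions to be numbered by naturals.\<close>

lemma countable_set_cformula: "countable (set_cformula \<phi>)"
proof (induction \<phi>)
  case (CNorm P)
  have "countable (set_star_poly P)" by (induction P) auto
  then show ?case by simp
qed (auto intro: countable_finite)

text \<open>Digits of the unknown functions become Boolean variables, digits of the parameters
  become Boolean parameters. The type prescribes, for every \<open>n\<close> and finite
  \<open>s\<close>, whether the pattern \<open>s\<close> below \<open>n\<close> occurs at some
  point.\<close>

theorem cs_countably_qf_saturated_cont_algebra:
  assumes X: "compact_space X" "zero_dimensional_space X"
    and sat: "ba_countably_saturated (clopen_algebra X)"
  shows "cs_countably_qf_saturated (cont_algebra X)"
  unfolding cs_countably_qf_saturated_def cs_countably_saturated_for_def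
proof (intro allI impI, elim conjE)
  let ?C = "cont_algebra X" and ?B = "clopen_algebra X"
  fix \<phi> :: "nat \<Rightarrow> ('a \<Rightarrow> complex) cformula" and K :: "nat \<Rightarrow> real set"
  assume \<phi>': "\<forall>n. \<phi> n \<in> {\<phi>. cf_wf \<phi> \<and> cf_quantifier_free \<phi>} \<and> set_cformula (\<phi> n) \<subseteq> cs_ball ?C 1"
    and K: "\<forall>n. compact (K n)"
    and approx: "\<forall>e>0. \<forall>F. finite F \<longrightarrow> (\<exists>b. (\<forall>k. b k \<in> cs_ball ?C 1) \<and>
      (\<forall>n\<in>F. cf_eval ?C b (\<phi> n) \<in> thicken (K n) e))"
  have \<phi>: "cf_wf (\<phi> n)" "cf_quantifier_free (\<phi> n)" "set_cformula (\<phi> n) \<subseteq> cs_ball ?C 1" for n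
    using \<phi>' by auto

  have "\<forall>m. \<exists>b. (\<forall>k. b k \<in> cs_ball ?C 1) \<and>
      (\<forall>n\<in>{..m}. cf_eval ?C b (\<phi> n) \<in> thicken (K n) (inverse (real (Suc m))))"
    using approx by (metis finite_atMost inverse_positive_iff_positive of_nat_0_less_iff zero_less_Suc)
  then obtain b0 where b0: "\<And>m k. b0 m k \<in> cs_ball ?C 1"
    and b0_approx: "\<And>m n. n \<le> m \<Longrightarrow> cf_eval ?C (b0 m) (\<phi> n) \<in> thicken (K n) (inverse (real (Suc m)))"
    by (metis atMost_iff)

  \<comment> \<open>The inserted element keeps \<open>Par\<close> nonempty, so that \<open>a\<close>
    enumerates exactly \<open>Par\<close>.\<close>
  define Par where "Par = insert (b0 0 0) (\<Union>n. set_cformula (\<phi> n))"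
  define a where "a = from_nat_into Par"
  have "countable Par" by (simp add: Par_def countable_set_cformula)
  then have range_a: "range a = Par" by (simp add: a_def range_from_nat_into Par_def)
  moreover have "Par \<subseteq> cs_ball ?C 1" using b0 \<phi>(3) unfolding Par_def by blast
  ultimately have a_ball: "a l \<in> cs_ball ?C 1" for l by blast
  define ix where "ix f = (SOME l. a l = f)" for f
  have a_ix: "a (ix f) = f" if "f \<in> Par" for f
    unfolding ix_def using that range_a by (metis (mono_tags) rangeE someI)

  define codes where "codes V f \<longleftrightarrow> (\<forall>j. openin X (V j) \<and> closedin X (V j)) \<and>
    (\<forall>x\<in>topspace X. f x = decode (\<lambda>j. x \<in> V j))" for V f
  \<comment> \<open>Each function gets one fixed code, so the digits of a parameter are the same for
    all approximate solutions.\<close>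
  define code where "code f = (SOME V. codes V f)" for f
  have ex: "\<exists>V. codes V f" if "f \<in> cs_ball ?C 1" for f
    unfolding codes_def using that X(1) by (intro ex_code[OF X]) (auto simp: cs_ball_cont_algebra)
  have codes: "codes (code f) f" if "f \<in> cs_ball ?C 1" for f
    unfolding code_def by (rule someI_ex[OF ex[OF that]])
  have code: "openin X (code f j) \<and> closedin X (code f j)"
    "x \<in> topspace X \<Longrightarrow> f x = decode (\<lambda>j. x \<in> code f j)" if "f \<in> cs_ball ?C 1" for f j x
    using codes[OF that] by (auto simp: codes_def)
  define var where "var m i = code (b0 m (fst (prod_decode i))) (snd (prod_decode i))" for m i
  define par where "par i = code (a (fst (prod_decode i))) (snd (prod_decode i))" for i
  have var: "openin X (var m i) \<and> closedin X (var m i)"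
    and par: "openin X (par i) \<and> closedin X (par i)" for m i
    using code(1)[OF b0] code(1)[OF a_ball] by (auto simp: var_def par_def)

  \<comment> \<open>Even indices are variable digits and odd ones parameter digits, matching the
    numbering in \<open>pat_eval\<close>.\<close>
  define t :: "nat \<Rightarrow> 'a set ba_term"
    where "t i = (if even i then BVar (i div 2) else BParam (par (i div 2)))" for i
  define pat where "pat v x = {i. x \<in> ba_eval ?B v (t i)}" for v x
  define R where "R n s v \<longleftrightarrow> (\<exists>x\<in>topspace X. pat v x \<inter> {..<n} = s \<inter> {..<n})" for n s v
  have pat: "2 * i \<in> pat v x \<longleftrightarrow> x \<in> v i" "2 * i + 1 \<in> pat v x \<longleftrightarrow> x \<in> par i" for v x i
    by (auto simp: pat_def t_def)
  have R_sat: "ba_sat ?B v (BEq (pat_term t n s) BZero) \<longleftrightarrow> \<not> R n s v" for n s v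
    by (auto simp: R_def ba_eval_pat_term pat_def)

  \<comment> \<open>A single number \<open>q\<close> encodes the pair of a length and a finite
    pattern.\<close>
  obtain r where r: "strict_mono r" and const:
    "\<And>q. (\<forall>\<^sub>F m in sequentially. R (fst (prod_decode q)) (set_decode (snd (prod_decode q))) (var (r m))) \<or>
          (\<forall>\<^sub>F m in sequentially. \<not> R (fst (prod_decode q)) (set_decode (snd (prod_decode q))) (var (r m)))"
    using ex_subseq_eventually_constant[of "\<lambda>q m. R (fst (prod_decode q)) (set_decode (snd (prod_decode q))) (var m)"]
    by blast
  define L where "L n s \<longleftrightarrow> (\<forall>\<^sub>F m in sequentially. R n s (var (r m)))" for n s
  have L: "\<forall>\<^sub>F m in sequentially. R n s (var (r m)) \<longleftrightarrow> L n s" if "finite s" for n s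
  proof -
    have "(\<forall>\<^sub>F m in sequentially. R n s (var (r m))) \<or> (\<forall>\<^sub>F m in sequentially. \<not> R n s (var (r m)))"
      using const[of "prod_encode (n, set_encode s)"] that by simp
    then show ?thesis
    proof
      assume *: "\<forall>\<^sub>F m in sequentially. R n s (var (r m))"
      then have "L n s" by (simp add: L_def)
      with * show ?thesis by simp
    next
      assume *: "\<forall>\<^sub>F m in sequentially. \<not> R n s (var (r m))"
      then have "\<not> L n s"
        unfolding L_def by (auto dest: eventually_conj)
      with * show ?thesis by simp
    qed
  qed

  define p where "p = (\<lambda>(n, s). if L n s then BNot (BEq (pat_term t n s) BZero) else BEq (pat_term t n s) BZero)"
  have p_sat: "ba_sat ?B v (p (n, s)) \<longleftrightarrow> (R n s v \<longleftrightarrow> L n s)" for v n s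
    using R_sat[of v n s] by (simp add: p_def)
  have "\<exists>v. (\<forall>k. v k \<in> ba_carrier ?B) \<and> (\<forall>q \<in> p ` (UNIV \<times> {s. finite s}). ba_sat ?B v q)"
  proof (rule sat[unfolded ba_countably_saturated_def, rule_format], intro conjI ballI allI impI)
    show "countable (p ` (UNIV \<times> {s. finite s}))"
      by (intro countable_image countable_SIGMA countable_Collect_finite) auto
    fix q assume "q \<in> p ` (UNIV \<times> {s. finite s})"
    moreover have "(\<Union>i. set_ba_term (t i)) \<subseteq> ba_carrier ?B"
      using par by (auto simp: t_def split: if_splits)
    ultimately show "set_ba_formula q \<subseteq> ba_carrier ?B"
      using set_pat_term[of t] by (fastforce simp: p_def split: if_splits)
  next
    fix S assume "S \<subseteq> p ` (UNIV \<times> {s. finite s})" "finite S"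
    then obtain Q where Q: "finite Q" "Q \<subseteq> UNIV \<times> {s. finite s}" "S = p ` Q"
      by (meson finite_subset_image)
    \<comment> \<open>Finitely many conditions stabilize together, so the codes of one late
      approximate solution satisfy them all.\<close>
    have "\<forall>\<^sub>F m in sequentially. \<forall>(n, s)\<in>Q. R n s (var (r m)) \<longleftrightarrow> L n s"
      using Q L by (intro eventually_ball_finite) auto
    then obtain m where "\<forall>(n, s)\<in>Q. R n s (var (r m)) \<longleftrightarrow> L n s"
      by (auto simp: eventually_sequentially)
    then have "\<forall>q\<in>S. ba_sat ?B (var (r m)) q" using p_sat Q(3) by fastforce
    then show "\<exists>v. (\<forall>k. v k \<in> ba_carrier ?B) \<and> (\<forall>q\<in>S. ba_sat ?B v q)"
      using var by auto
  qed
  then obtain v where v: "\<And>k. openin X (v k)" "\<And>k. closedin X (v k)"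
    and "\<forall>q \<in> p ` (UNIV \<times> {s. finite s}). ba_sat ?B v q" by auto
  then have Rv: "R n s v \<longleftrightarrow> L n s" if "finite s" for n s
    using that p_sat by blast

  have patterns: "\<forall>\<^sub>F m in sequentially.
      (\<lambda>x. pat (var (r m)) x \<inter> {..<n}) ` topspace X = (\<lambda>x. pat v x \<inter> {..<n}) ` topspace X" for n
  proof -
    \<comment> \<open>Only the finitely many subsets of \<open>{..<n}\<close> can be truncated
      patterns, so their occurrences stabilize simultaneously.\<close>
    have "\<forall>\<^sub>F m in sequentially. \<forall>s\<in>Pow {..<n}. R n s (var (r m)) \<longleftrightarrow> R n s v"
      using L Rv by (intro eventually_ball_finite ballI) (auto simp: finite_subset)
    then show ?thesis
    proof eventually_elim
      case (elim m)
      have "s \<in> (\<lambda>x. pat w x \<inter> {..<n}) ` topspace X \<longleftrightarrow> s \<in> Pow {..<n} \<and> R n s w" for s w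
        by (auto simp: R_def image_iff Int_absorb2)
      with elim show ?case by blast
    qed
  qed

  define b where "b k = (\<lambda>x\<in>topspace X. decode (\<lambda>j. x \<in> v (prod_encode (k, j))))" for k
  have conv: "(\<lambda>m. cf_eval ?C (b0 (r m)) \<psi>) \<longlonglongrightarrow> cf_eval ?C b \<psi>"
    if "cf_wf \<psi>" "cf_quantifier_free \<psi>" "set_cformula \<psi> \<subseteq> Par" for \<psi>
  proof (rule tendsto_cf_eval_quantifier_free[where p = "\<lambda>m. pat (var (r m))" and q = "pat v" and ix = ix])
    fix x m k assume x: "x \<in> topspace X"
    show "b0 (r m) k x = decode (\<lambda>j. 2 * prod_encode (k, j) \<in> pat (var (r m)) x)"
      using code(2)[OF b0 x] by (simp add: pat var_def)
    show "b k x = decode (\<lambda>j. 2 * prod_encode (k, j) \<in> pat v x)"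
      using x by (simp add: pat b_def)
  next
    fix f m x assume f: "f \<in> set_cformula \<psi>" and x: "x \<in> topspace X"
    then have "a (ix f) = f" using that a_ix by blast
    then show "f x = decode (\<lambda>j. 2 * prod_encode (ix f, j) + 1 \<in> pat (var (r m)) x) \<and>
        f x = decode (\<lambda>j. 2 * prod_encode (ix f, j) + 1 \<in> pat v x)"
      using code(2)[OF a_ball x, of "ix f"] unfolding pat by (simp add: par_def)
  qed (use patterns that in auto)

  have b_cont: "continuous_map X euclidean (b k)" for k
    unfolding b_def continuous_map_restrict_topspace using v by (intro continuous_map_decode)
  have b_ball: "b k \<in> cs_ball ?C 1" for k
  proof -
    \<comment> \<open>The norm of a variable is itself a quantifier-free formula, so the bound 1
      passes to the limit.\<close>
    have "(\<lambda>m. cs_norm ?C (b0 (r m) k)) \<longlonglongrightarrow> cs_norm ?C (b k)"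
      using conv[of "CNorm (PVar k)"] by simp
    then have "cs_norm ?C (b k) \<le> 1"
      by (rule LIMSEQ_le_const2) (use b0 in \<open>auto simp: cs_ball_def\<close>)
    then show ?thesis using b_cont[of k] by (simp add: cs_ball_def b_def)
  qed
  have "cf_eval ?C b (\<phi> n) \<in> K n" for n
  proof -
    have "(\<lambda>m. cf_eval ?C (b0 (r m)) (\<phi> n)) \<longlonglongrightarrow> cf_eval ?C b (\<phi> n)"
      using \<phi> by (intro conv) (auto simp: Par_def)
    then have lim: "(\<lambda>m. infdist (cf_eval ?C (b0 (r m)) (\<phi> n)) (K n)) \<longlonglongrightarrow> infdist (cf_eval ?C b (\<phi> n)) (K n)"
      by (rule tendsto_infdist)
    have "infdist (cf_eval ?C (b0 (r m)) (\<phi> n)) (K n) \<le> inverse (real (Suc m))" if "m \<ge> n" for m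
    proof -
      have "m \<le> r m" using r by (rule seq_suble)
      then have "infdist (cf_eval ?C (b0 (r m)) (\<phi> n)) (K n) < inverse (real (Suc (r m)))"
        using b0_approx[of n "r m"] that by (simp add: thicken_def)
      also have "\<dots> \<le> inverse (real (Suc m))" using \<open>m \<le> r m\<close> by (intro le_imp_inverse_le) auto
      finally show ?thesis by simp
    qed
    then have "infdist (cf_eval ?C b (\<phi> n)) (K n) \<le> 0"
      by (intro LIMSEQ_le[OF lim LIMSEQ_inverse_real_of_nat]) blast
    \<comment> \<open>Needed because \<open>infdist\<close> to the empty set is 0;
      \<open>thicken\<close> has already excluded this case.\<close>
    moreover have "K n \<noteq> {}" using b0_approx[of n n] by (simp add: thicken_def)
    ultimately show ?thesis
      using K by (metis compact_imp_closed in_closed_iff_infdist_zero infdist_nonneg order_antisym)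
  qed
  then show "\<exists>b. (\<forall>k. b k \<in> cs_ball ?C 1) \<and> (\<forall>n. cf_eval ?C b (\<phi> n) \<in> K n)"
    using b_ball by blast
qed

theorem mainTheorem6:
  fixes X :: "'a topology"
  assumes "compact_space X"
    and "Hausdorff_space X"
    and "zero_dimensional_space X"
  shows "(cs_countably_saturated (cont_algebra X) \<longrightarrow> ba_countably_saturated (clopen_algebra X)) \<and>
    (ba_countably_saturated (clopen_algebra X) \<longrightarrow> cs_countably_qf_saturated (cont_algebra X))"
  using ba_countably_saturated_clopen_algebra[OF assms(1)]
    cs_countably_qf_saturated_cont_algebra[OF assms(1,3)]
  by blast

end
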